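(* Let $B:[0,1)^2\to[0,1)^2$ be the baker's transformation defined by \[ B(x,y)=\begin{cases}(2x,\frac y2)&\text{if }0\le x<\frac12,\\(2x-1,\frac y2+\frac12)&\text{if }\frac12\le x<1.\end{cases} \] Assume that $f\in L^2([0,1)^2)$ has an absolutely convergent expansion with respect to the product Walsh system on the square $[0,1)^2$. Then, for every $\eta>0$ and for almost every $x\in[0,1)^2$, \[ \lim_{N\to+\infty}\frac{\sqrt N}{(\log(1+N))^{\frac32+\eta}}\bigg|\frac1N\sum_{n=0}^{N-1}f(B^nx)-\int_{[0,1)^2}f(y)\,dy\bigg|=0 . \]
   Context: Let $r_k(x)=\mathrm{sgn}(\sin(2^k\pi x))$ for $k\in\mathbb N=\{1,2,\dots\}$, $x\in[0,1)$, be the Rademacher functions. On $[0,1)^2$ put $R_k(x,y)=r_{k+1}(x)$ for $k=0,1,2,\dots$ and $R_k(x,y)=r_{|k|}(y)$ for $k=-1,-2,\dots$. For integers $k_1<k_2<\dots<k_n$ ($k_j\in\mathbb Z$, $n\in\mathbb N$) put $W_{k_1k_2\cdots k_n}=R_{k_1}R_{k_2}\cdots R_{k_n}$. The product Walsh system consists of the constant function $1$ together with all the functions $W_{k_1\cdots k_n}$; it is an orthonormal basis of $L^2([0,1)^2)$ with Lebesgue measure. An absolutely convergent expansion means that the coefficients of $f$ with respect to this system are absolutely summable. *)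

theory Defs
  imports "HOL-Analysis.Analysis"
begin

definition unit_square :: "(real \<times> real) set" where
  "unit_square = {0..<1} \<times> {0..<1}"

definition rademacher :: "nat \<Rightarrow> real \<Rightarrow> real" where
  "rademacher k x = sgn (sin (2 ^ k * pi * x))"

definition rademacher2 :: "int \<Rightarrow> real \<times> real \<Rightarrow> real" where
  "rademacher2 k p =
     (if k \<ge> 0 then rademacher (nat k + 1) (fst p) else rademacher (nat \<bar>k\<bar>) (snd p))"

text \<open>
  The indices \<open>k\<^sub>1 < \<dots> < k\<^sub>n\<close> of a product Walsh function are encoded by the finite set
  \<open>{k\<^sub>1, \<dots>, k\<^sub>n}\<close> of integers; the empty set gives the constant function \<open>1\<close>.
\<close>

definition walsh2 :: "int set \<Rightarrow> real \<times> real \<Rightarrow> real" where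
  "walsh2 K p = (\<Prod>k\<in>K. rademacher2 k p)"

definition walsh2_coeff :: "(real \<times> real \<Rightarrow> complex) \<Rightarrow> int set \<Rightarrow> complex" where
  "walsh2_coeff f K =
     integral\<^sup>L (lebesgue_on unit_square) (\<lambda>p. f p * complex_of_real (walsh2 K p))"

definition L2_fun :: "'a measure \<Rightarrow> ('a \<Rightarrow> complex) \<Rightarrow> bool" where
  "L2_fun M f \<longleftrightarrow> f \<in> borel_measurable M \<and> integrable M (\<lambda>x. (norm (f x))\<^sup>2)"

definition abs_convergent_walsh2 :: "(real \<times> real \<Rightarrow> complex) \<Rightarrow> bool" where
  "abs_convergent_walsh2 f \<longleftrightarrow> (\<lambda>K. norm (walsh2_coeff f K)) summable_on {K. finite K}"

text \<open>Only the values of the following map on \<^const>\<open>unit_square\<close>, which it maps to itself, matter.\<close>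

definition baker :: "real \<times> real \<Rightarrow> real \<times> real" where
  "baker p = (case p of (x, y) \<Rightarrow>
     if x < 1/2 then (2 * x, y / 2) else (2 * x - 1, y / 2 + 1/2))"

end

theory Submission
  imports Defs "HOL-Library.Log_Nat"
begin

text \<open>
  Almost everywhere \<open>R\<^sub>k \<circ> B = R\<^bsub>k+1\<^esub>\<close>, so \<open>B\<close> acts on the Walsh functions by translation of the
  index set. For a fixed nonempty \<open>K\<close> the translates of \<open>W\<^sub>K\<close> are orthonormal, and since the coefficients
  of \<open>f\<close> are absolutely summable with sum at most \<open>A\<close>, the triangle inequality in \<open>L\<^sup>2\<close> shows that a
  block of \<open>b - a\<close> consecutive terms of the centred orbit sum has squared \<open>L\<^sup>2\<close> norm at most
  \<open>A\<^sup>2 (b - a)\<close>. The Rademacher--Menshov argument turns this into a maximal inequality over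
  \<open>N < 2 ^ m\<close> with an additional factor \<open>m\<^sup>2\<close>, and summation over \<open>m\<close> with the weights
  \<open>2 ^ (- m) m powr (- 3 - 2 \<eta>)\<close> gives the rate almost everywhere.
\<close>

section \<open>The Rademacher--Menshov argument\<close>

text \<open>Two features of \<open>f\<close> shape the proof. It is given only up to null sets,
  whereas orbit sums use its values at single points. It is therefore replaced by the sum of its
  Walsh series, which converges absolutely everywhere; this needs completeness of the system,
  obtained from binary expansions, and invariance of the measure, which carries an almost everywhere
  identity to whole orbits. Moreover, centred terms of an orbit need not be orthogonal, since
  translates of different index sets may coincide; the maximal argument therefore starts from a
  second-moment bound linear in the block length. In the rate, one factor \<open>m\<close> is the
  Cauchy--Schwarz loss over the binary levels, another is the number of levels, and
  \<open>m powr (1 + 2 * \<eta>)\<close> makes the remaining series converge. The square root of the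
  product is the power \<open>3/2 + \<eta>\<close> of the logarithm.\<close>

lemma binary_block_bound:
  fixes X :: "nat \<Rightarrow> 'b::real_normed_vector"
  assumes "N < 2 ^ m"
  shows "(norm (\<Sum>n<N. X n))\<^sup>2
    \<le> real m * (\<Sum>j<m. \<Sum>i<2 ^ (m - j). (norm (\<Sum>n\<in>{i * 2 ^ j..<Suc i * 2 ^ j}. X n))\<^sup>2)"
proof -
  define q where "q j = (\<Sum>i<2 ^ (m - j). (norm (\<Sum>n\<in>{i * 2 ^ j..<Suc i * 2 ^ j}. X n))\<^sup>2)" for j
  \<comment> \<open>Telescoping over the binary truncations of \<open>N\<close>: consecutive ones differ by at most one dyadic block.\<close>
  define S where "S j = (\<Sum>n < N div 2 ^ j * 2 ^ j. X n)" for j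
  have q0: "q j \<ge> 0" for j unfolding q_def by (intro sum_nonneg) auto
  have step: "norm (S j - S (Suc j)) \<le> sqrt (q j)" if "j < m" for j
  proof (cases "even (N div 2 ^ j)")
    case True
    then have "N div 2 ^ j * 2 ^ j = N div 2 ^ Suc j * 2 ^ Suc j"
      by (simp add: div_mult2_eq mult.commute[of 2] flip: mult.assoc) 
    then have "S j = S (Suc j)" unfolding S_def by (rule arg_cong)
    then show ?thesis using q0 by simp
  next
    case False
    \<comment> \<open>An odd quotient \<open>Suc i\<close> drops by one when its last binary digit
      is cleared, so the difference is block number \<open>i\<close> of level
      \<open>j\<close>.\<close>
    define i where "i = N div 2 ^ j - 1"
    have i: "N div 2 ^ j = Suc i" using False unfolding i_def by (cases "N div 2 ^ j") auto
    have *: "N div 2 ^ Suc j * 2 ^ Suc j = i * 2 ^ j"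
      using False i by (simp add: div_mult2_eq mult.commute[of 2] flip: mult.assoc)
    have "N div 2 ^ j < 2 ^ (m - j)"
      using assms that by (simp add: less_mult_imp_div_less flip: power_add)
    then have il: "i < 2 ^ (m - j)" using i by simp
    have eq: "S j - S (Suc j) = (\<Sum>n\<in>{i * 2 ^ j..<Suc i * 2 ^ j}. X n)"
      unfolding S_def * i by (simp add: lessThan_atLeast0 sum_diff_nat_ivl)
    have "(norm (S j - S (Suc j)))\<^sup>2 \<le> q j"
      unfolding eq q_def
      using il by (intro member_le_sum[of i "{..<2 ^ (m - j)}"
          "\<lambda>i. (norm (\<Sum>n\<in>{i * 2 ^ j..<Suc i * 2 ^ j}. X n))\<^sup>2"]) auto
    then show ?thesis by (simp add: real_le_rsqrt)
  qed
  have "(\<Sum>j<m. S j - S (Suc j)) = S 0 - S m"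
    by (rule sum_lessThan_telescope')
  moreover have "S m = 0" "S 0 = (\<Sum>n<N. X n)"
    using assms by (auto simp: S_def)
  ultimately have "norm (\<Sum>n<N. X n) = norm (\<Sum>j<m. S j - S (Suc j))" by simp
  also have "\<dots> \<le> (\<Sum>j<m. sqrt (q j))"
    by (rule sum_norm_le) (use step in auto)
  finally have "(norm (\<Sum>n<N. X n))\<^sup>2 \<le> (\<Sum>j<m. sqrt (q j))\<^sup>2"
    by (intro power_mono) auto
  also have "\<dots> \<le> (\<Sum>j<m. 1\<^sup>2) * (\<Sum>j<m. (sqrt (q j))\<^sup>2)"
    using Cauchy_Schwarz_ineq_sum[of "\<lambda>_. 1" "\<lambda>j. sqrt (q j)" "{..<m}"] by simp
  also have "\<dots> = real m * (\<Sum>j<m. q j)"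
    using q0 by simp
  finally show ?thesis unfolding q_def .
qed

text \<open>Hypothesis \<open>C\<close> holds for orthogonal variables with bounded second moments
  and, unlike orthogonality, survives absolutely convergent superposition of such sequences. The
  limit comes from a single integrable series over the dyadic scales of \<open>N\<close>.\<close>

lemma rademacher_menshov_rate:
  fixes X :: "nat \<Rightarrow> 'a \<Rightarrow> 'b::{real_normed_vector, second_countable_topology}"
  assumes X [measurable]: "\<And>n. X n \<in> borel_measurable M"
    and C: "\<And>a b. a \<le> b \<Longrightarrow>
      (\<integral>\<^sup>+ x. ennreal ((norm (\<Sum>n\<in>{a..<b}. X n x))\<^sup>2) \<partial>M) \<le> ennreal (C * real (b - a))"
    and "C \<ge> 0" "\<eta> > 0"
  shows "AE x in M. (\<lambda>N. norm (\<Sum>n<N. X n x) /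
    (sqrt (real N) * ln (1 + real N) powr (3/2 + \<eta>))) \<longlonglongrightarrow> 0"
proof -
  define q where "q j i x = (norm (\<Sum>n\<in>{i * 2 ^ j..<Suc i * 2 ^ j}. X n x))\<^sup>2" for j i :: nat and x
  have [measurable]: "q j i \<in> borel_measurable M" for j i unfolding q_def by measurable
  \<comment> \<open>The right-hand side of \<open>binary_block_bound\<close> depends on
    \<open>m\<close> but not on \<open>N\<close>, so \<open>V m x\<close> bounds the squared partial
    sums for all \<open>N < 2 ^ m\<close> at once.\<close>
  define V where "V m x = real m * (\<Sum>j<m. \<Sum>i<2 ^ (m - j). q j i x)" for m x
  have [measurable]: "V m \<in> borel_measurable M" for m unfolding V_def by measurable
  have q0: "q j i x \<ge> 0" for j i x by (simp add: q_def)
  have V0: "V m x \<ge> 0" for m x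
    unfolding V_def by (intro mult_nonneg_nonneg sum_nonneg q0) auto
  \<comment> \<open>Level \<open>j\<close> has \<open>2 ^ (m - j)\<close> blocks of length
    \<open>2 ^ j\<close>, so every level contributes \<open>C * 2 ^ m\<close>; the number of levels
    and the prefactor give \<open>m ^ 2\<close>.\<close>
  have VI: "(\<integral>\<^sup>+ x. ennreal (V m x) \<partial>M) \<le> ennreal (C * real m ^ 2 * 2 ^ m)" for m
  proof -
    have qI: "(\<integral>\<^sup>+ x. ennreal (q j i x) \<partial>M) \<le> ennreal (C * 2 ^ j)" for j i
      using C[of "i * 2 ^ j" "Suc i * 2 ^ j"] by (simp add: q_def)
    have "(\<integral>\<^sup>+ x. ennreal (V m x) \<partial>M)
        = (\<integral>\<^sup>+ x. ennreal (real m) * (\<Sum>j<m. \<Sum>i<2 ^ (m - j). ennreal (q j i x)) \<partial>M)"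
      unfolding V_def by (simp add: ennreal_mult sum_nonneg q0 flip: sum_ennreal)
    also have "\<dots> = ennreal (real m) * (\<Sum>j<m. \<Sum>i<2 ^ (m - j). \<integral>\<^sup>+ x. ennreal (q j i x) \<partial>M)"
      by (simp add: nn_integral_cmult nn_integral_sum)
    also have "\<dots> \<le> ennreal (real m) * (\<Sum>j<m. \<Sum>i<(2::nat) ^ (m - j). ennreal (C * 2 ^ j))"
      by (intro mult_left_mono sum_mono qI) auto
    also have "\<dots> = ennreal (real m * (\<Sum>j<m. \<Sum>i<(2::nat) ^ (m - j). C * 2 ^ j))"
      using \<open>C \<ge> 0\<close> by (subst sum_ennreal sum_nonneg | simp add: ennreal_mult sum_nonneg)+
    also have "(\<Sum>j<m. \<Sum>i<(2::nat) ^ (m - j). C * 2 ^ j) = (\<Sum>j<m. C * 2 ^ m)"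
      by (intro sum.cong) (auto simp flip: power_add)
    finally show ?thesis by (simp add: power2_eq_square mult_ac)
  qed
  define u where "u m x = V m x / (2 ^ m * real m powr (3 + 2 * \<eta>))" for m x
  have [measurable]: "u m \<in> borel_measurable M" for m unfolding u_def by measurable
  have u0: "u m x \<ge> 0" for m x by (simp add: u_def V0)
  have uI: "(\<integral>\<^sup>+ x. ennreal (u m x) \<partial>M) \<le> ennreal (C * real m powr (-1 - 2 * \<eta>))" for m
  proof (cases "m = 0")
    case False
    define w where "w = 1 / (2 ^ m * real m powr (3 + 2 * \<eta>))"
    have w: "w \<ge> 0" by (simp add: w_def)
    have "(\<integral>\<^sup>+ x. ennreal (u m x) \<partial>M) = (\<integral>\<^sup>+ x. ennreal w * ennreal (V m x) \<partial>M)"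
      using V0 w by (simp add: u_def w_def flip: ennreal_mult)
    also have "\<dots> = ennreal w * (\<integral>\<^sup>+ x. ennreal (V m x) \<partial>M)"
      by (simp add: nn_integral_cmult)
    also have "\<dots> \<le> ennreal w * ennreal (C * real m ^ 2 * 2 ^ m)"
      by (intro mult_left_mono VI) auto
    also have "\<dots> = ennreal (w * (C * real m ^ 2 * 2 ^ m))"
      using w \<open>C \<ge> 0\<close> by (simp add: ennreal_mult)
    also have "w * (C * real m ^ 2 * 2 ^ m) = C * real m powr (-1 - 2 * \<eta>)"
    proof -
      have "real m powr (-1 - 2 * \<eta>) = real m powr 2 / real m powr (3 + 2 * \<eta>)"
        by (subst powr_diff[symmetric]) simp
      also have "real m powr 2 = (real m)\<^sup>2" by simp
      finally show ?thesis by (simp add: w_def)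
    qed
    finally show ?thesis .
  qed (simp add: u_def V_def)
  have sm: "summable (\<lambda>m. C * real m powr (-1 - 2 * \<eta>))"
    using \<open>\<eta> > 0\<close> by (intro summable_mult) (simp add: summable_real_powr_iff)
  \<comment> \<open>Monotone convergence takes the place of a Borel--Cantelli argument: a
    nonnegative series with finite integral converges almost everywhere, so its terms tend to
    0.\<close>
  have "(\<integral>\<^sup>+ x. (\<Sum>m. ennreal (u m x)) \<partial>M) = (\<Sum>m. \<integral>\<^sup>+ x. ennreal (u m x) \<partial>M)"
    by (rule nn_integral_suminf) simp
  also have "\<dots> \<le> (\<Sum>m. ennreal (C * real m powr (-1 - 2 * \<eta>)))"
    by (intro suminf_le uI) auto
  also have "\<dots> < \<infinity>"
    using sm \<open>C \<ge> 0\<close> by (subst suminf_ennreal2) auto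
  finally have "AE x in M. (\<Sum>m. ennreal (u m x)) \<noteq> \<infinity>"
    by (intro nn_integral_noteq_infinite) auto
  then show ?thesis
  proof eventually_elim
    case (elim x)
    have "summable (\<lambda>m. u m x)"
      using elim u0 by (intro summable_suminf_not_top) auto
    then have u_lim: "(\<lambda>m. u m x) \<longlonglongrightarrow> 0" by (rule summable_LIMSEQ_zero)
    \<comment> \<open>With \<open>m\<close> the bit length \<open>floorlog 2 N\<close>, the factor 2
      comes from \<open>2 ^ m \<le> 2 * N\<close> and the base \<open>2 / ln 2\<close> from
      \<open>m * ln 2 / 2 \<le> ln (1 + N)\<close>. The latter uses
      \<open>m / 2 \<le> m - 1\<close>, hence the restriction to \<open>N \<ge> 2\<close>
      below.\<close>
    define c where "c = 2 * (2 / ln 2 :: real) powr (3 + 2 * \<eta>)"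
    have fl: "filterlim (\<lambda>N::nat. floorlog 2 N) at_top at_top"
      unfolding filterlim_at_top
    proof
      fix Z
      show "\<forall>\<^sub>F N in sequentially. Z \<le> floorlog 2 N"
        using eventually_ge_at_top[of "2 ^ Z"]
      proof eventually_elim
        case (elim N)
        have "(2::nat) ^ (Z - 1) \<le> 2 ^ Z" by simp
        then show ?case using elim by (intro floorlog_geI order_trans[OF _ elim]) auto
      qed
    qed
    have "(\<lambda>N. sqrt (c * u (floorlog 2 N) x)) \<longlonglongrightarrow> sqrt (c * 0)"
      by (intro tendsto_intros filterlim_compose[OF u_lim fl])
    then have lim: "(\<lambda>N. sqrt (c * u (floorlog 2 N) x)) \<longlonglongrightarrow> 0" by simp
    show ?case
    proof (rule tendsto_sandwich[OF _ _ tendsto_const lim])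
      show "\<forall>\<^sub>F N in sequentially. 0 \<le> norm (\<Sum>n<N. X n x) /
          (sqrt (real N) * ln (1 + real N) powr (3/2 + \<eta>))" by simp
      show "\<forall>\<^sub>F N in sequentially. norm (\<Sum>n<N. X n x) /
          (sqrt (real N) * ln (1 + real N) powr (3/2 + \<eta>)) \<le> sqrt (c * u (floorlog 2 N) x)"
        using eventually_ge_at_top[of 2]
      proof eventually_elim
        case (elim N)
        define m where "m = floorlog 2 N"
        have b: "2 ^ (m - 1) \<le> N" "N < 2 ^ m"
          using floorlog_bounds[of N 2] elim by (auto simp: m_def)
        have m2: "m \<ge> 2"
        proof (rule ccontr)
          assume "\<not> m \<ge> 2" then have "m = 0 \<or> m = 1" by auto
          then show False using b elim by auto
        qed
        have bN: "2 ^ m \<le> 2 * real N"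
        proof -
          have "2 ^ m = 2 * (2::nat) ^ (m - 1)" using m2 by (cases m) auto
          also have "\<dots> \<le> 2 * N" using b by simp
          finally have "real (2 ^ m) \<le> real (2 * N)" by (rule of_nat_mono)
          then show ?thesis by simp
        qed
        have "(ln 2 / 2) * real m \<le> real (m - 1) * ln 2"
        proof -
          have "real m / 2 \<le> real (m - 1)" using m2 by simp
          from mult_right_mono[OF this, of "ln 2"] show ?thesis by (simp add: mult_ac)
        qed
        also have "\<dots> = ln (2 ^ (m - 1))" by (simp add: ln_realpow)
        also have "\<dots> \<le> ln (1 + real N)"
        proof (subst ln_le_cancel_iff)
          have "(2::real) ^ (m - 1) \<le> real N"
            using b by (metis of_nat_le_iff of_nat_power of_nat_numeral)
          then show "(2::real) ^ (m - 1) \<le> 1 + real N" by linarith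
        qed auto
        finally have lnb: "(ln 2 / 2) * real m \<le> ln (1 + real N)" .
        have "((ln 2 / 2) * real m) powr (3 + 2 * \<eta>) \<le> ln (1 + real N) powr (3 + 2 * \<eta>)"
          using lnb \<open>\<eta> > 0\<close> by (intro powr_mono2) auto
        then have L: "(ln 2 / 2) powr (3 + 2 * \<eta>) * real m powr (3 + 2 * \<eta>)
            \<le> ln (1 + real N) powr (3 + 2 * \<eta>)"
          by (subst (asm) powr_mult) auto
        define P where "P = (ln 2 / 2 :: real) powr (3 + 2 * \<eta>)"
        have P: "P > 0" by (simp add: P_def)
        have cP: "c = 2 / P"
          unfolding c_def P_def by (simp add: powr_divide)
        define R where "R = real m powr (3 + 2 * \<eta>)"
        have R: "R > 0" using m2 by (simp add: R_def)
        define Q where "Q = ln (1 + real N) powr (3 + 2 * \<eta>)"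
        have Q: "Q > 0" using elim by (simp add: Q_def)
        have D: "2 ^ m * R * P \<le> 2 * (real N * Q)"
        proof -
          have "2 ^ m * (P * R) \<le> (2 * real N) * Q"
            using bN L P R unfolding P_def R_def Q_def by (intro mult_mono) auto
          then show ?thesis by (simp add: mult_ac)
        qed
        have "(norm (\<Sum>n<N. X n x) / (sqrt (real N) * ln (1 + real N) powr (3/2 + \<eta>)))\<^sup>2
            = (norm (\<Sum>n<N. X n x))\<^sup>2 / (real N * Q)"
          using elim by (simp add: power_divide power_mult_distrib Q_def powr_power mult.commute algebra_simps)
        also have "\<dots> \<le> V m x / (real N * Q)"
          using binary_block_bound[OF b(2), of "\<lambda>n. X n x"] Q
          unfolding V_def q_def by (intro divide_right_mono) auto
        also have "\<dots> \<le> V m x / (2 ^ m * R * P / 2)"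
          using D P R V0[of m x] elim Q by (intro divide_left_mono) auto
        also have "\<dots> = c * u m x"
          unfolding cP u_def R_def[symmetric] by (simp add: mult_ac)
        finally show ?case unfolding m_def by (rule real_le_rsqrt)
      qed
    qed
  qed
qed

section \<open>The baker map and the Walsh functions\<close>

text \<open>On Borel sets, composition with Borel maps stays measurable; the completion returns only
  in the passage to \<open>lebesgue_on unit_square\<close> at the end.\<close>

abbreviation square_measure :: "(real \<times> real) measure" where
  "square_measure \<equiv> restrict_space lborel unit_square"

text \<open>
  At dyadic coordinates \<^const>\<open>rademacher\<close> takes the value \<open>0\<close>, which breaks both the shift relation
  with \<^const>\<open>baker\<close> and the product formula for Walsh functions; \<open>generic\<close> excludes this null set.
\<close>

definition generic :: "(real \<times> real) set" where
  "generic = {p \<in> unit_square. \<forall>k. rademacher2 k p \<noteq> 0}"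

lemma unit_square_sets [measurable]: "unit_square \<in> sets borel"
  unfolding unit_square_def by (intro borel_Times) auto

lemma space_square_measure [simp]: "space square_measure = unit_square"
  by (simp add: space_restrict_space)

lemma emeasure_square_measure:
  "A \<subseteq> unit_square \<Longrightarrow> emeasure square_measure A = emeasure lborel A"
  by (rule emeasure_restrict_space) auto

lemma emeasure_unit_square: "emeasure lborel unit_square = 1"
  unfolding unit_square_def
  by (simp add: lborel.emeasure_pair_measure_Times flip: lborel_prod)

lemma finite_square_measure: "finite_measure square_measure"
  by (intro finite_measureI) (simp add: emeasure_square_measure emeasure_unit_square)

lemma rademacher_measurable [measurable]: "rademacher k \<in> borel_measurable borel"
  unfolding rademacher_def by measurable

lemma rademacher2_measurable [measurable]: "rademacher2 k \<in> borel_measurable borel"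
  unfolding rademacher2_def
  unfolding borel_prod[symmetric] by measurable

lemma walsh2_measurable [measurable]: "walsh2 K \<in> borel_measurable borel"
  unfolding walsh2_def by measurable

lemma abs_rademacher2_le: "\<bar>rademacher2 k p\<bar> \<le> 1"
  by (simp add: rademacher2_def rademacher_def abs_sgn_eq)

lemma abs_walsh2_le: "\<bar>walsh2 K p\<bar> \<le> 1"
  unfolding walsh2_def abs_prod by (intro prod_le_1) (auto simp: abs_rademacher2_le)

lemma rademacher2_cases: "rademacher2 k p \<in> {-1, 0, 1}"
  by (simp add: rademacher2_def rademacher_def sgn_real_def)

lemma generic_rademacher2: "p \<in> generic \<Longrightarrow> rademacher2 k p = 1 \<or> rademacher2 k p = -1"
  using rademacher2_cases[of k p] by (auto simp: generic_def)

lemma countable_rademacher_zeros: "countable {x. rademacher k x = 0}"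
proof (rule countable_subset)
  show "{x. rademacher k x = 0} \<subseteq> range (\<lambda>i::int. of_int i / 2 ^ k)"
  proof clarify
    fix x assume "rademacher k x = 0"
    then have "sin (2 ^ k * pi * x) = 0" by (simp add: rademacher_def sgn_zero_iff)
    then obtain i :: int where "2 ^ k * pi * x = of_int i * pi"
      by (auto simp: sin_zero_iff_int2)
    then have "x = of_int i / 2 ^ k" by (simp add: field_simps)
    then show "x \<in> range (\<lambda>i::int. of_int i / 2 ^ k)" by blast
  qed
qed auto

lemma AE_generic: "AE p in square_measure. p \<in> generic"
proof -
  have null: "C \<times> (UNIV :: real set) \<in> null_sets lborel" "(UNIV :: real set) \<times> C \<in> null_sets lborel"
    if "countable C" for C :: "real set"
  proof -
    have C: "C \<in> null_sets lborel" using that by (rule countable_imp_null_set_lborel)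
    then have "emeasure lborel (C \<times> (UNIV::real set)) = 0"
      "emeasure lborel ((UNIV::real set) \<times> C) = 0"
      using null_setsD1[OF C] null_setsD2[OF C]
      by (simp_all add: lborel.emeasure_pair_measure_Times flip: lborel_prod)
    moreover have "C \<times> (UNIV::real set) \<in> sets lborel" "(UNIV::real set) \<times> C \<in> sets lborel"
      using C by (auto intro!: borel_Times)
    ultimately show "C \<times> (UNIV :: real set) \<in> null_sets lborel" "(UNIV :: real set) \<times> C \<in> null_sets lborel"
      by (auto intro!: null_setsI)
  qed
  have "AE p in lborel. rademacher2 k p \<noteq> 0" for k
  proof (cases "k \<ge> 0")
    case True
    show ?thesis
      by (rule AE_I'[OF null(1)[OF countable_rademacher_zeros[of "nat k + 1"]]])
        (use True in \<open>auto simp: rademacher2_def\<close>)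
  next
    case False
    show ?thesis
      by (rule AE_I'[OF null(2)[OF countable_rademacher_zeros[of "nat \<bar>k\<bar>"]]])
        (use False in \<open>auto simp: rademacher2_def\<close>)
  qed
  then have "AE p in lborel. \<forall>k. rademacher2 k p \<noteq> 0" by (simp add: AE_all_countable)
  then show ?thesis
    by (subst AE_restrict_space_iff) (auto simp: generic_def)
qed

section \<open>Binary digits and the baker map\<close>

lemma rademacher_shift_int: "k \<ge> 1 \<Longrightarrow> rademacher k (x + of_int i) = rademacher k x"
proof -
  assume "k \<ge> 1"
  then obtain j where k: "k = Suc j" by (cases k) auto
  have "2 ^ k * pi * (x + of_int i) = 2 ^ k * pi * x + of_int (2 ^ j * i) * (2 * pi)"
    by (simp add: k algebra_simps)
  then have "sin (2 ^ k * pi * (x + of_int i)) = sin (2 ^ k * pi * x)"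
    by (simp only: sin.plus_of_int[where 'a = real, unfolded of_real_eq_id id_apply])
  then show ?thesis by (simp add: rademacher_def)
qed

lemma rademacher_half_scale: "rademacher (Suc k) (x / 2) = rademacher k x"
  by (simp add: rademacher_def mult.assoc)

text \<open>\<open>rademacher k\<close> has period \<open>2 powr (1 - k)\<close>, which divides
  \<open>1/2\<close> only from \<open>k = 2\<close> on. At \<open>k = 1\<close> the half shift
  reverses the sign, and \<open>half_swap\<close> exploits this exception.\<close>

lemma rademacher_half_shift: "k \<ge> 2 \<Longrightarrow> rademacher k (x + 1/2) = rademacher k x"
  using rademacher_shift_int[of "k - 1" "2 * x" 1] rademacher_half_scale[of "k - 1" "2 * x + 1"]
    rademacher_half_scale[of "k - 1" "2 * x"]
  by (simp add: add_divide_distrib)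

lemma rademacher_1: 
  assumes "0 < x" "x < 1"
  shows "rademacher (Suc 0) x = (if x < 1/2 then 1 else if x = 1/2 then 0 else -1)"
proof (cases x "1/2::real" rule: linorder_cases)
  case less
  have "sin (2 * pi * x) > 0"
    using assms less by (intro sin_gt_zero) (auto simp: field_simps)
  then show ?thesis using less by (simp add: rademacher_def)
next
  case equal
  show ?thesis unfolding equal by (simp add: rademacher_def)
next
  case greater
  have "sin (2 * pi * x) < 0"
    using assms greater by (intro sin_lt_zero) (auto simp: field_simps)
  then show ?thesis using greater by (simp add: rademacher_def)
qed

lemma generic_coords:
  assumes "p \<in> generic"
  shows "0 < fst p" "fst p < 1" "0 < snd p" "snd p < 1" "fst p \<noteq> 1/2"
proof -
  have r: "rademacher (Suc 0) (fst p) \<noteq> 0" "rademacher (Suc 0) (snd p) \<noteq> 0"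
  proof -
    have "rademacher2 0 p \<noteq> 0" "rademacher2 (-1) p \<noteq> 0" using assms by (auto simp: generic_def)
    then show "rademacher (Suc 0) (fst p) \<noteq> 0" "rademacher (Suc 0) (snd p) \<noteq> 0"
      by (auto simp: rademacher2_def)
  qed
  then have 0: "fst p \<noteq> 0" "snd p \<noteq> 0"
    by (auto simp: rademacher_def)
  then show "0 < fst p" "fst p < 1" "0 < snd p" "snd p < 1"
    using assms by (auto simp: generic_def unit_square_def)
  then show "fst p \<noteq> 1/2" using r rademacher_1[of "fst p"] by auto
qed

text \<open>Write \<open>R_k = 1 - 2 * d_k\<close> with binary digits \<open>d_k\<close>, where the
  indices \<open>0, 1, ...\<close> belong to \<open>x\<close> and \<open>-1, -2, ...\<close> to
  \<open>y\<close>. The baker map is the shift of this two-sided sequence: doubling drops the first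
  digit of \<open>x\<close>, and halving \<open>y\<close> with or without the added
  \<open>1/2\<close> writes that digit in front of \<open>y\<close>. Only \<open>k = -1\<close>
  connects the two coordinates.\<close>

lemma rademacher2_baker:
  assumes "p \<in> generic"
  shows "rademacher2 k (baker p) = rademacher2 (k + 1) p"
proof -
  obtain x y where p: "p = (x, y)" by (cases p)
  note c = generic_coords[OF assms, unfolded p, simplified]
  consider "k \<ge> 0" | "k = -1" | "k \<le> -2" by linarith
  then show ?thesis
  proof cases
    case 1
    have "fst (baker p) = 2 * x \<or> fst (baker p) = 2 * x + of_int (-1)"
      by (auto simp: baker_def p)
    then have "rademacher (nat k + 1) (fst (baker p)) = rademacher (nat k + 1) (2 * x)"
      using rademacher_shift_int[of "nat k + 1" "2 * x" "-1"] by auto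
    also have "\<dots> = rademacher (nat k + 2) x"
      using rademacher_half_scale[of "nat k + 1" "2 * x"] by simp
    finally show ?thesis using 1 by (simp add: rademacher2_def p nat_add_distrib)
  next
    case 2
    then show ?thesis
      using c by (auto simp: rademacher2_def p baker_def rademacher_1)
  next
    case 3
    define j where "j = nat \<bar>k\<bar> - 1"
    have j: "nat \<bar>k\<bar> = Suc j" "nat \<bar>k + 1\<bar> = j" "j \<ge> 1" using 3 by (auto simp: j_def)
    have "snd (baker p) = y / 2 \<or> snd (baker p) = y / 2 + 1/2"
      by (auto simp: baker_def p)
    then have "rademacher (Suc j) (snd (baker p)) = rademacher (Suc j) (y / 2)"
      using j rademacher_half_shift[of "Suc j"] by auto
    then show ?thesis
      using 3 j by (simp add: rademacher2_def p rademacher_half_scale)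
  qed
qed

lemma baker_unit_square: "p \<in> unit_square \<Longrightarrow> baker p \<in> unit_square"
  by (auto simp: baker_def unit_square_def split: prod.splits)

lemma baker_generic: "p \<in> generic \<Longrightarrow> baker p \<in> generic"
  using rademacher2_baker[of p] by (simp add: generic_def baker_unit_square)

lemma walsh2_baker:
  assumes "p \<in> generic"
  shows "walsh2 K (baker p) = walsh2 ((\<lambda>k. k + 1) ` K) p"
  unfolding walsh2_def using assms
  by (simp add: rademacher2_baker prod.reindex inj_on_def)

lemma baker_funpow_generic: "p \<in> generic \<Longrightarrow> (baker ^^ n) p \<in> generic"
  by (induction n) (auto simp: baker_generic)

lemma walsh2_baker_funpow:
  assumes "p \<in> generic"
  shows "walsh2 K ((baker ^^ n) p) = walsh2 ((\<lambda>k. k + int n) ` K) p"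
proof (induction n arbitrary: K)
  case (Suc n)
  have "walsh2 K ((baker ^^ Suc n) p) = walsh2 ((\<lambda>k. k + 1) ` K) ((baker ^^ n) p)"
    using walsh2_baker[OF baker_funpow_generic[OF assms]] by simp
  also have "\<dots> = walsh2 ((\<lambda>k. k + int (Suc n)) ` K) p"
    unfolding Suc by (simp add: image_image add_ac)
  finally show ?case .
qed simp

text \<open>Exchanging the coordinates reflects the two-sided digit sequence; this turns the
  expansion of \<open>fst p\<close> into that of \<open>snd p\<close>.\<close>

lemma generic_swap: "p \<in> generic \<Longrightarrow> prod.swap p \<in> generic"
  and rademacher2_swap: "rademacher2 k (prod.swap p) = rademacher2 (- k - 1) p"
proof -
  show R: "rademacher2 k (prod.swap p) = rademacher2 (- k - 1) p" for k p
    by (cases "k \<ge> 0") (auto simp: rademacher2_def nat_add_distrib nat_diff_distrib 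
      intro!: arg_cong2[where f = rademacher])
  assume "p \<in> generic"
  then show "prod.swap p \<in> generic"
    by (auto simp: generic_def R unit_square_def)
qed

section \<open>Invariance of the measure\<close>

lemma baker_measurable [measurable]: "baker \<in> borel_measurable borel"
  unfolding baker_def borel_prod[symmetric] by measurable

lemma baker_measurable_square: "baker \<in> measurable square_measure square_measure"
  by (intro measurable_restrict_space3) (auto simp: baker_unit_square)

lemma emeasure_lborel_vimage_affine:
  fixes a b s t :: real
  assumes A: "A \<in> sets borel" and "\<bar>a * b\<bar> = 1"
  shows "emeasure lborel ((\<lambda>(x, y). (a * x + s, b * y + t)) -` A) = emeasure lborel A"
proof -
  define c where "c j = (if j = (1, 0) then a else b)" for j :: "real \<times> real"
  have B: "(Basis :: (real \<times> real) set) = {(1, 0), (0, 1)}"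
    by (auto simp: Basis_prod_def)
  define T where "T = (\<lambda>p. (s, t) + (\<Sum>j\<in>Basis. (c j * (p \<bullet> j)) *\<^sub>R j))"
  have T: "T = (\<lambda>(x, y). (a * x + s, b * y + t))"
    by (auto simp: T_def B c_def fun_eq_iff)
  have [measurable]: "T \<in> borel_measurable borel"
    unfolding T borel_prod[symmetric] by measurable
  have "a \<noteq> 0" "b \<noteq> 0" using assms by auto
  then have "lborel = density (distr lborel borel T) (\<lambda>_. (\<Prod>j\<in>Basis. \<bar>c j\<bar>))"
    unfolding T_def by (intro lborel_affine_euclidean) (auto simp: c_def)
  also have "(\<Prod>j\<in>Basis. \<bar>c j\<bar>) = 1"
    using assms by (simp add: B c_def abs_mult)
  finally have *: "lborel = distr lborel borel T"
    by (simp add: density_1)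
  have "emeasure lborel A = emeasure (distr lborel borel T) A" using * by simp
  also have "\<dots> = emeasure lborel (T -` A)"
    using A by (subst emeasure_distr) auto
  finally show ?thesis unfolding T by simp
qed

text \<open>Two affine pieces with determinant of absolute value 1 preserve area if both the pieces
  and their images partition the square. \<open>H\<close> cuts the domain and \<open>H'\<close> the
  image; the \<open>onto\<close> hypotheses keep the affine preimage of an image piece inside its
  domain piece. The criterion serves the baker map and the half swap alike.\<close>

lemma distr_square_measure_eqI:
  fixes T :: "real \<times> real \<Rightarrow> real \<times> real"
  assumes T: "T \<in> measurable square_measure square_measure"
    and H: "H \<in> sets borel" and H': "H' \<in> sets borel"
    and ab: "\<bar>a * b\<bar> = 1" "\<bar>a' * b'\<bar> = 1"
    and T1: "\<And>x y. (x, y) \<in> unit_square \<Longrightarrow> (x, y) \<in> H \<Longrightarrow>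
      T (x, y) = (a * x + s, b * y + t) \<and> T (x, y) \<in> H'"
    and T2: "\<And>x y. (x, y) \<in> unit_square \<Longrightarrow> (x, y) \<notin> H \<Longrightarrow>
      T (x, y) = (a' * x + s', b' * y + t') \<and> T (x, y) \<notin> H'"
    and onto1: "\<And>x y. (a * x + s, b * y + t) \<in> unit_square \<Longrightarrow> (a * x + s, b * y + t) \<in> H' \<Longrightarrow>
      (x, y) \<in> unit_square \<and> (x, y) \<in> H"
    and onto2: "\<And>x y. (a' * x + s', b' * y + t') \<in> unit_square \<Longrightarrow> (a' * x + s', b' * y + t') \<notin> H' \<Longrightarrow>
      (x, y) \<in> unit_square \<and> (x, y) \<notin> H"
  shows "distr square_measure square_measure T = square_measure"
proof (rule measure_eqI)
  fix A assume "A \<in> sets (distr square_measure square_measure T)"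
  then have A: "A \<in> sets borel" "A \<subseteq> unit_square" and A': "A \<in> sets square_measure"
    by (auto simp: sets_restrict_space_iff)
  have "T -` A \<inter> unit_square \<in> sets square_measure"
    using measurable_sets[OF T A'] by simp
  then have m: "T -` A \<inter> unit_square \<in> sets borel"
    by (auto simp: sets_restrict_space_iff)
  have e1: "T -` A \<inter> unit_square \<inter> H = (\<lambda>(x, y). (a * x + s, b * y + t)) -` (A \<inter> H')"
    using A(2) by (auto dest: T1 onto1 simp: subset_eq)
  have e2: "T -` A \<inter> unit_square - H = (\<lambda>(x, y). (a' * x + s', b' * y + t')) -` (A - H')"
    using A(2) by (auto dest: T2 onto2 simp: subset_eq)
  have "emeasure (distr square_measure square_measure T) A = emeasure lborel (T -` A \<inter> unit_square)"
    using T A' by (subst emeasure_distr) (auto simp: emeasure_square_measure)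
  also have "\<dots> = emeasure lborel (T -` A \<inter> unit_square \<inter> H) + emeasure lborel (T -` A \<inter> unit_square - H)"
    using m H by (subst plus_emeasure) (auto intro!: arg_cong[where f = "emeasure lborel"])
  also have "\<dots> = emeasure lborel (A \<inter> H') + emeasure lborel (A - H')"
    unfolding e1 e2 using A H' ab
    by (intro arg_cong2[where f = "(+)"] emeasure_lborel_vimage_affine) auto
  also have "\<dots> = emeasure lborel A"
    using A H' by (subst plus_emeasure) (auto intro!: arg_cong[where f = "emeasure lborel"])
  also have "\<dots> = emeasure square_measure A"
    using A by (simp add: emeasure_square_measure)
  finally show "emeasure (distr square_measure square_measure T) A = emeasure square_measure A" .
qed simp

lemma distr_baker: "distr square_measure square_measure baker = square_measure"
proof (rule distr_square_measure_eqI[where H = "{p. fst p < 1/2}" and H' = "{p. snd p < 1/2}"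
    and a = 2 and b = "1/2" and s = 0 and t = 0 and a' = 2 and b' = "1/2" and s' = "-1" and t' = "1/2"])
  show "baker \<in> measurable square_measure square_measure" by (rule baker_measurable_square)
  show "{p :: real \<times> real. fst p < 1/2} \<in> sets borel" "{p :: real \<times> real. snd p < 1/2} \<in> sets borel"
    by (intro borel_open borel_closed open_Collect_less closed_Collect_le continuous_intros)+
qed (auto simp: unit_square_def baker_def)

text \<open>This map changes the sign of \<open>R\<^sub>0\<close> and preserves all \<open>R\<^sub>k\<close> with \<open>k > 0\<close>.\<close>

definition half_swap :: "real \<times> real \<Rightarrow> real \<times> real" where
  "half_swap p = (if fst p < 1/2 then fst p + 1/2 else fst p - 1/2, snd p)"

lemma half_swap_measurable [measurable]: "half_swap \<in> borel_measurable borel"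
  unfolding half_swap_def borel_prod[symmetric] by measurable

lemma half_swap_measurable_square: "half_swap \<in> measurable square_measure square_measure"
  by (intro measurable_restrict_space3) (auto simp: half_swap_def unit_square_def)

lemma distr_half_swap: "distr square_measure square_measure half_swap = square_measure"
proof (rule distr_square_measure_eqI[where H = "{p. fst p < 1/2}" and H' = "{p. fst p \<ge> 1/2}"
    and a = 1 and b = 1 and s = "1/2" and t = 0 and a' = 1 and b' = 1 and s' = "-1/2" and t' = 0])
  show "half_swap \<in> measurable square_measure square_measure" by (rule half_swap_measurable_square)
  show "{p :: real \<times> real. fst p < 1/2} \<in> sets borel" "{p :: real \<times> real. fst p \<ge> 1/2} \<in> sets borel"
    by (intro borel_open borel_closed open_Collect_less closed_Collect_le continuous_intros)+
qed (auto simp: unit_square_def half_swap_def)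

section \<open>Orthonormality of the Walsh functions\<close>

lemma walsh2_measurable_square [measurable]: "walsh2 K \<in> borel_measurable square_measure"
  by (rule measurable_restrict_space1) measurable

lemma integral_square_measure_one: "integral\<^sup>L square_measure (\<lambda>_. 1 :: real) = 1"
  by (simp add: measure_def emeasure_square_measure emeasure_unit_square)

lemma integral_walsh2_shift_Suc:
  "integral\<^sup>L square_measure (walsh2 ((\<lambda>k. k + 1) ` K)) = integral\<^sup>L square_measure (walsh2 K)"
proof -
  have "integral\<^sup>L square_measure (walsh2 K) =
      integral\<^sup>L (distr square_measure square_measure baker) (walsh2 K)"
    by (simp only: distr_baker)
  also have "\<dots> = (\<integral>p. walsh2 K (baker p) \<partial>square_measure)"
    by (rule integral_distr[OF baker_measurable_square]) measurable
  also have "\<dots> = integral\<^sup>L square_measure (walsh2 ((\<lambda>k. k + 1) ` K))"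
  proof (rule integral_cong_AE)
    show "AE p in square_measure. walsh2 K (baker p) = walsh2 ((\<lambda>k. k + 1) ` K) p"
      using AE_generic by eventually_elim (rule walsh2_baker)
    show "(\<lambda>p. walsh2 K (baker p)) \<in> borel_measurable square_measure"
      by (rule measurable_compose[OF baker_measurable_square]) measurable
  qed measurable
  finally show ?thesis by simp
qed

lemma integral_walsh2_shift:
  "integral\<^sup>L square_measure (walsh2 ((\<lambda>k. k + int n) ` K)) = integral\<^sup>L square_measure (walsh2 K)"
proof (induction n)
  case (Suc n)
  have "(\<lambda>k. k + int (Suc n)) ` K = (\<lambda>k. k + 1) ` (\<lambda>k. k + int n) ` K"
    by (auto simp: image_image add_ac)
  then show ?case using Suc integral_walsh2_shift_Suc by simp
qed simp

lemma walsh2_half_swap: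
  assumes p: "p \<in> generic" and K: "finite K" "0 \<in> K" "\<And>k. k \<in> K \<Longrightarrow> k \<ge> 0"
  shows "walsh2 K (half_swap p) = - walsh2 K p"
proof -
  note c = generic_coords[OF p]
  have 0: "rademacher2 0 (half_swap p) = - rademacher2 0 p"
    using c by (simp add: rademacher2_def half_swap_def rademacher_1)
  have k: "rademacher2 k (half_swap p) = rademacher2 k p" if "k \<in> K - {0}" for k
  proof -
    have "k > 0" using that K(3)[of k] by auto
    then show ?thesis
      using rademacher_half_shift[of "nat k + 1" "fst p"]
        rademacher_half_shift[of "nat k + 1" "fst p - 1/2"]
      by (simp add: rademacher2_def half_swap_def)
  qed
  have "(\<Prod>k\<in>K - {0}. rademacher2 k (half_swap p)) = (\<Prod>k\<in>K - {0}. rademacher2 k p)"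
    using k by (rule prod.cong[OF refl])
  then show ?thesis
    unfolding walsh2_def prod.remove[OF K(1,2)] 0 by simp
qed

lemma integral_walsh2_eq_0:
  assumes "finite K" "K \<noteq> {}"
  shows "integral\<^sup>L square_measure (walsh2 K) = 0"
proof -
  define m where "m = Min K"
  \<comment> \<open>Powers of the baker map move the smallest index to \<open>0\<close>, where the half swap applies.\<close>
  define L where "L = (\<lambda>k. k - m) ` K"
  have mK: "m \<in> K" "\<And>k. k \<in> K \<Longrightarrow> m \<le> k"
    using assms by (auto simp: m_def)
  have L: "finite L" "0 \<in> L" "\<And>k. k \<in> L \<Longrightarrow> k \<ge> 0"
    using mK assms by (auto simp: L_def)
  have "integral\<^sup>L square_measure (walsh2 K) = integral\<^sup>L square_measure (walsh2 L)"
  proof (cases "m \<ge> 0")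
    case True
    then have "K = (\<lambda>k. k + int (nat m)) ` L" by (auto simp: L_def image_image)
    then show ?thesis using integral_walsh2_shift by metis
  next
    case False
    then have "L = (\<lambda>k. k + int (nat (- m))) ` K" by (auto simp: L_def)
    then show ?thesis using integral_walsh2_shift by metis
  qed
  moreover have "integral\<^sup>L square_measure (walsh2 L) = - integral\<^sup>L square_measure (walsh2 L)"
  proof -
    have "integral\<^sup>L square_measure (walsh2 L) =
        integral\<^sup>L (distr square_measure square_measure half_swap) (walsh2 L)"
      by (simp only: distr_half_swap)
    also have "\<dots> = (\<integral>p. walsh2 L (half_swap p) \<partial>square_measure)"
      by (rule integral_distr[OF half_swap_measurable_square]) measurable
    also have "\<dots> = (\<integral>p. - walsh2 L p \<partial>square_measure)"
    proof (rule integral_cong_AE)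
      show "AE p in square_measure. walsh2 L (half_swap p) = - walsh2 L p"
        using AE_generic by eventually_elim (rule walsh2_half_swap[OF _ L])
      show "(\<lambda>p. walsh2 L (half_swap p)) \<in> borel_measurable square_measure"
        by (rule measurable_compose[OF half_swap_measurable_square]) measurable
    qed measurable
    finally show ?thesis by simp
  qed
  ultimately show ?thesis by simp
qed

text \<open>On \<open>generic\<close> every factor squares to 1, so common indices cancel. Up to a
  null set the Walsh functions thus form a group, and orthogonality reduces to the vanishing mean of
  the nonconstant ones.\<close>

lemma walsh2_mult:
  assumes p: "p \<in> generic" and "finite K" "finite L"
  shows "walsh2 K p * walsh2 L p = walsh2 (sym_diff K L) p"
proof -
  have sq: "rademacher2 k p * rademacher2 k p = 1" for k
    using generic_rademacher2[OF p, of k] by auto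
  have split: "walsh2 A p = walsh2 (A - B) p * walsh2 (A \<inter> B) p" if "finite A" for A B
    using prod.Int_Diff[OF that, of "\<lambda>k. rademacher2 k p" B]
    by (simp add: walsh2_def mult.commute)
  have "walsh2 (K \<inter> L) p * walsh2 (K \<inter> L) p = 1"
    by (simp add: walsh2_def sq flip: prod.distrib)
  then have "walsh2 K p * walsh2 L p = walsh2 (K - L) p * walsh2 (L - K) p"
    using split[OF assms(2), of L] split[OF assms(3), of K] by (simp add: Int_commute)
  also have "\<dots> = walsh2 (sym_diff K L) p"
    unfolding walsh2_def using assms by (intro prod.union_disjoint[symmetric]) auto
  finally show ?thesis .
qed

lemma integral_walsh2_mult:
  assumes "finite K" "finite L"
  shows "(\<integral>p. walsh2 K p * walsh2 L p \<partial>square_measure) = (if K = L then 1 else 0)"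
proof -
  have "(\<integral>p. walsh2 K p * walsh2 L p \<partial>square_measure) = integral\<^sup>L square_measure (walsh2 (sym_diff K L))"
    by (rule integral_cong_AE, measurable) (use AE_generic walsh2_mult[OF _ assms] in auto)
  also have "\<dots> = (if K = L then 1 else 0)"
  proof (cases "K = L")
    case True
    then have "walsh2 (sym_diff K L) = (\<lambda>_. 1)" by (simp add: walsh2_def fun_eq_iff)
    then show ?thesis using True integral_square_measure_one by simp
  next
    case False
    then show ?thesis using assms integral_walsh2_eq_0[of "sym_diff K L"] by auto
  qed
  finally show ?thesis .
qed

section \<open>Completeness of the Walsh system\<close>

lemma integrable_mult_walsh2:
  fixes h :: "real \<times> real \<Rightarrow> complex"
  assumes "integrable square_measure h"
  shows "integrable square_measure (\<lambda>p. h p * complex_of_real (walsh2 K p))"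
proof (rule Bochner_Integration.integrable_bound[OF assms])
  have [measurable]: "h \<in> borel_measurable square_measure" using assms by auto
  show "(\<lambda>p. h p * complex_of_real (walsh2 K p)) \<in> borel_measurable square_measure" by measurable
  show "AE p in square_measure. norm (h p * complex_of_real (walsh2 K p)) \<le> norm (h p)"
    using abs_walsh2_le by (auto simp: norm_mult mult_left_le)
qed

text \<open>Arbitrary Borel sets \<open>S k\<close>, rather than prescribed signs, make the family
  closed under intersection and turn every preimage under \<open>rademacher2 k\<close> within the
  square into a cylinder, the value 0 included.\<close>

definition cylinder :: "int set \<Rightarrow> (int \<Rightarrow> real set) \<Rightarrow> (real \<times> real) set" where
  "cylinder K S = {p \<in> unit_square. \<forall>k\<in>K. rademacher2 k p \<in> S k}"

definition cylinders :: "(real \<times> real) set set" where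
  "cylinders = {cylinder K S | K S. finite K \<and> (\<forall>k. S k \<in> sets borel)}"

lemma cylinder_sets:
  assumes "finite K" "\<And>k. S k \<in> sets borel"
  shows "cylinder K S \<in> sets square_measure"
proof -
  have "{p \<in> space square_measure. \<forall>k\<in>K. rademacher2 k p \<in> S k} \<in> sets square_measure"
  proof (rule sets.sets_Collect_finite_All[OF _ assms(1)])
    fix k
    have R: "rademacher2 k \<in> borel_measurable square_measure"
      by (rule measurable_restrict_space1) measurable
    show "{p \<in> space square_measure. rademacher2 k p \<in> S k} \<in> sets square_measure"
      using measurable_sets[OF R assms(2)[of k]]
      by (simp add: vimage_def Int_def conj_commute)
  qed
  then show ?thesis by (simp add: cylinder_def)
qed

lemma Int_stable_cylinders: "Int_stable cylinders"
proof (rule Int_stableI)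
  fix A B assume "A \<in> cylinders" "B \<in> cylinders"
  then obtain K S L T where
    A: "A = cylinder K S" "finite K" "\<And>k. S k \<in> sets borel" and
    B: "B = cylinder L T" "finite L" "\<And>k. T k \<in> sets borel"
    unfolding cylinders_def by blast
  define U where "U k = (if k \<in> K then S k else UNIV) \<inter> (if k \<in> L then T k else UNIV)" for k
  have "A \<inter> B = cylinder (K \<union> L) U"
    unfolding A B by (auto simp: cylinder_def U_def)
  moreover have "U k \<in> sets borel" for k using A B by (simp add: U_def)
  ultimately show "A \<inter> B \<in> cylinders" unfolding cylinders_def using A B by blast
qed

text \<open>Every function on the two values \<open>1\<close> and \<open>-1\<close> is affine, so a
  constraint on \<open>R_k\<close> is a combination of \<open>1\<close> and \<open>R_k\<close>, and
  cylinder indicators are Walsh polynomials almost everywhere. The factor \<open>walsh2 L\<close>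
  lets the induction absorb \<open>R_k\<close> into \<open>L\<close>; disjointness of
  \<open>K\<close> and \<open>L\<close> ensures that \<open>k\<close> is new there.\<close>

lemma integral_cylinder_eq_0:
  fixes h :: "real \<times> real \<Rightarrow> complex"
  assumes h: "integrable square_measure h"
    and coeff: "\<And>K. finite K \<Longrightarrow> (\<integral>p. h p * complex_of_real (walsh2 K p) \<partial>square_measure) = 0"
    and S: "\<And>k. S k \<in> sets borel"
    and "finite K" "finite L" "K \<inter> L = {}"
  shows "(\<integral>p. indicator (cylinder K S) p *\<^sub>R (h p * complex_of_real (walsh2 L p)) \<partial>square_measure) = 0"
  using \<open>finite K\<close> \<open>finite L\<close> \<open>K \<inter> L = {}\<close>
proof (induction K arbitrary: L rule: finite_induct)
  case empty
  have "(\<integral>p. indicator (cylinder {} S) p *\<^sub>R (h p * complex_of_real (walsh2 L p)) \<partial>square_measure)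
     = (\<integral>p. h p * complex_of_real (walsh2 L p) \<partial>square_measure)"
    by (rule Bochner_Integration.integral_cong) (auto simp: cylinder_def)
  then show ?case using coeff empty by simp
next
  case (insert k K)
  \<comment> \<open>\<open>\<alpha>\<close> and \<open>\<beta>\<close> are the even and odd parts of
    the indicator of \<open>S k\<close> on \<open>1\<close> and \<open>-1\<close>, so
    \<open>\<alpha> + \<beta> * r\<close> is its value at such an \<open>r\<close>.\<close>
  define \<alpha> where "\<alpha> = (indicator (S k) 1 + indicator (S k) (- 1) :: real) / 2"
  define \<beta> where "\<beta> = (indicator (S k) 1 - indicator (S k) (- 1) :: real) / 2"
  have int: "integrable square_measure
      (\<lambda>p. indicator (cylinder K S) p *\<^sub>R (h p * complex_of_real (walsh2 L p)))" for L
    by (intro integrable_mult_indicator cylinder_sets integrable_mult_walsh2 h S insert.hyps)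
  have [measurable]: "cylinder K S \<in> sets square_measure" "cylinder (insert k K) S \<in> sets square_measure"
    using insert.hyps S by (auto intro!: cylinder_sets)
  have [measurable]: "h \<in> borel_measurable square_measure" using h by auto
  have "(\<integral>p. indicator (cylinder (insert k K) S) p *\<^sub>R (h p * complex_of_real (walsh2 L p)) \<partial>square_measure)
    = (\<integral>p. \<alpha> *\<^sub>R (indicator (cylinder K S) p *\<^sub>R (h p * complex_of_real (walsh2 L p))) +
        \<beta> *\<^sub>R (indicator (cylinder K S) p *\<^sub>R (h p * complex_of_real (walsh2 (insert k L) p))) \<partial>square_measure)"
  proof (rule integral_cong_AE)
    show "AE p in square_measure. indicator (cylinder (insert k K) S) p *\<^sub>R (h p * complex_of_real (walsh2 L p))
      = \<alpha> *\<^sub>R (indicator (cylinder K S) p *\<^sub>R (h p * complex_of_real (walsh2 L p))) +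
        \<beta> *\<^sub>R (indicator (cylinder K S) p *\<^sub>R (h p * complex_of_real (walsh2 (insert k L) p)))"
      using AE_generic
    proof eventually_elim
      case (elim p)
      have "k \<notin> L" using insert.prems by auto
      then have W: "walsh2 (insert k L) p = rademacher2 k p * walsh2 L p"
        using insert.prems by (simp add: walsh2_def)
      have I: "indicator (cylinder (insert k K) S) p
          = (\<alpha> + \<beta> * rademacher2 k p) * (indicator (cylinder K S) p :: real)"
        using generic_rademacher2[OF elim, of k]
        by (auto simp: cylinder_def \<alpha>_def \<beta>_def indicator_def field_simps)
      show ?case unfolding W I by (simp add: scaleR_conv_of_real algebra_simps)
    qed
  qed measurable
  also have "\<dots> = 0"
    using insert.IH[of L] insert.IH[of "insert k L"] insert.hyps insert.prems int
    by (simp del: scaleR_scaleR)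
  finally show ?case .
qed

text \<open>\<open>(1 - R_k) / 2\<close> is the binary digit. One baker step removes the leading
  digit and doubles the rest, so after \<open>n\<close> steps the remainder is
  \<open>(1/2) ^ n\<close> times an orbit coordinate in the unit interval.\<close>

lemma binary_expansion_fst:
  assumes "p \<in> generic"
  shows "(\<lambda>k. (1 - rademacher2 (int k) p) / 2 * (1/2) ^ Suc k) sums fst p"
proof -
  have 1: "fst q = (1 - rademacher2 0 q) / 4 + fst (baker q) / 2" if "q \<in> generic" for q
    using generic_coords[OF that]
    by (auto simp: rademacher2_def rademacher_1 baker_def field_simps split: prod.splits)
  have *: "fst q = (\<Sum>k<n. (1 - rademacher2 (int k) q) / 2 * (1/2) ^ Suc k) + fst ((baker ^^ n) q) * (1/2) ^ n"
    if "q \<in> generic" for n q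
    using that
  proof (induction n arbitrary: q)
    case (Suc n)
    have "fst (baker q) = (\<Sum>k<n. (1 - rademacher2 (int k) (baker q)) / 2 * (1/2) ^ Suc k)
        + fst ((baker ^^ n) (baker q)) * (1/2) ^ n"
      by (rule Suc.IH[OF baker_generic[OF Suc.prems]])
    also have "(\<Sum>k<n. (1 - rademacher2 (int k) (baker q)) / 2 * (1/2) ^ Suc k)
        = 2 * (\<Sum>k<n. (1 - rademacher2 (int (Suc k)) q) / 2 * (1/2) ^ Suc (Suc k))"
      unfolding sum_distrib_left
      by (intro sum.cong) (simp_all add: rademacher2_baker[OF Suc.prems] add.commute)
    finally show ?case
      using 1[OF Suc.prems] unfolding sum.lessThan_Suc_shift
      by (simp add: funpow_Suc_right del: funpow.simps)
  qed simp
  have "(\<lambda>n. fst ((baker ^^ n) p) * (1/2) ^ n) \<longlonglongrightarrow> 0"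
  proof (rule tendsto_sandwich[of "\<lambda>_. 0" _ _ "\<lambda>n. (1/2 :: real) ^ n"])
    show "(\<lambda>n. (1/2 :: real) ^ n) \<longlonglongrightarrow> 0" by (rule LIMSEQ_power_zero) simp
  qed (use generic_coords(1,2)[OF baker_funpow_generic[OF assms]] in
      \<open>auto intro!: always_eventually mult_left_le_one_le less_imp_le\<close>)
  then have "(\<lambda>n. fst p - fst ((baker ^^ n) p) * (1/2) ^ n) \<longlonglongrightarrow> fst p - 0"
    by (intro tendsto_intros)
  moreover have "(\<Sum>k<n. (1 - rademacher2 (int k) p) / 2 * (1/2) ^ Suc k)
      = fst p - fst ((baker ^^ n) p) * (1/2) ^ n" for n
    using *[OF assms, of n] by linarith
  ultimately show ?thesis unfolding sums_def by simp
qed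

lemma binary_expansion_snd:
  assumes "p \<in> generic"
  shows "(\<lambda>k. (1 - rademacher2 (- int k - 1) p) / 2 * (1/2) ^ Suc k) sums snd p"
  using binary_expansion_fst[OF generic_swap[OF assms]] by (simp add: rademacher2_swap)

text \<open>Cylinders reduce the claim to integrals of \<open>h\<close> over sets: their indicators
  are Walsh polynomials almost everywhere, they are stable under intersection, and up to null sets
  they generate the Borel subsets of the square. A Dynkin argument extends the zero integral to all
  of these.\<close>

lemma walsh2_complete:
  fixes h :: "real \<times> real \<Rightarrow> complex"
  assumes h: "integrable square_measure h"
    and coeff: "\<And>K. finite K \<Longrightarrow> (\<integral>p. h p * complex_of_real (walsh2 K p) \<partial>square_measure) = 0"
  shows "AE p in square_measure. h p = 0"
proof (rule sigma_finite_measure.density_zero[OF _ h])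
  interpret finite_measure square_measure by (rule finite_square_measure)
  show "sigma_finite_measure square_measure" by unfold_locales
  have [measurable]: "h \<in> borel_measurable square_measure" using h by auto
  have sub: "cylinders \<subseteq> sets square_measure"
    unfolding cylinders_def using cylinder_sets by auto
  have pow: "cylinders \<subseteq> Pow unit_square"
    by (auto simp: cylinders_def cylinder_def)
  have sub': "sigma_sets unit_square cylinders \<subseteq> sets square_measure"
    using sets.sigma_sets_subset[OF sub] by simp
  have si: "set_integrable square_measure A h" if "A \<in> sets square_measure" for A
    unfolding set_integrable_def using that h by (rule integrable_mult_indicator)
  \<comment> \<open>The coefficient of the empty index set; the complement case of the induction
    needs the integral over the whole square.\<close>
  have total: "(LINT p:unit_square|square_measure. h p) = 0"
  proof -
    have "(LINT p:unit_square|square_measure. h p) = (\<integral>p. h p * complex_of_real (walsh2 {} p) \<partial>square_measure)"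
      unfolding set_lebesgue_integral_def
      by (rule Bochner_Integration.integral_cong) (auto simp: walsh2_def)
    then show ?thesis using coeff[of "{}"] by simp
  qed
  have zero: "(LINT p:A|square_measure. h p) = 0" if "A \<in> sigma_sets unit_square cylinders" for A
    using Int_stable_cylinders pow that
  proof (induction rule: sigma_sets_induct_disjoint)
    case (basic A)
    then obtain K S where A: "A = cylinder K S" "finite K" "\<And>k. S k \<in> sets borel"
      unfolding cylinders_def by blast
    show ?case
      using integral_cylinder_eq_0[OF h coeff A(3,2), of "{}"]
      by (simp add: A set_lebesgue_integral_def walsh2_def)
  next
    case empty
    then show ?case by (simp add: set_lebesgue_integral_def)
  next
    case (compl A)
    have A: "A \<in> sets square_measure" using compl(1) sub' by auto
    have "unit_square - A \<in> sets square_measure" using sets.compl_sets[OF A] by simp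
    then have "(LINT p:A \<union> (unit_square - A)|square_measure. h p)
        = (LINT p:A|square_measure. h p) + (LINT p:unit_square - A|square_measure. h p)"
      using A by (intro set_integral_Un si) auto
    moreover have "A \<union> (unit_square - A) = unit_square"
      using sets.sets_into_space[OF A] by auto
    ultimately show ?case using compl total by simp
  next
    case (union A)
    have Ai: "A i \<in> sets square_measure" for i using union(2) sub' by blast
    have "(LINT p:(\<Union>i. A i)|square_measure. h p) = (\<Sum>i. (LINT p:A i|square_measure. h p))"
    proof (intro lebesgue_integral_countable_add si sets.countable_UN)
      show "A i \<inter> A j = {}" if "i \<noteq> j" for i j
        using union(1) that by (auto simp: disjoint_family_on_def)
    qed (use Ai in auto)
    then show ?case using union by simp
  qed
  define N where "N = sigma unit_square cylinders"
  have N: "space N = unit_square" "sets N = sigma_sets unit_square cylinders"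
    unfolding N_def using pow by auto
  have [measurable]: "rademacher2 k \<in> borel_measurable N" for k
  proof (rule measurableI)
    fix T :: "real set" assume "T \<in> sets borel"
    then have "cylinder {k} (\<lambda>_. T) \<in> cylinders" unfolding cylinders_def by blast
    moreover have "rademacher2 k -` T \<inter> space N = cylinder {k} (\<lambda>_. T)"
      by (auto simp: cylinder_def N)
    ultimately show "rademacher2 k -` T \<inter> space N \<in> sets N" by (auto simp: N)
  qed simp
  \<comment> \<open>Binary expansion: \<open>\<phi>\<close> is measurable for the cylinders alone, yet is the identity almost everywhere.\<close>
  define \<phi> where "\<phi> p = ((\<Sum>k. (1 - rademacher2 (int k) p) / 2 * (1/2) ^ Suc k),
    (\<Sum>k. (1 - rademacher2 (- int k - 1) p) / 2 * (1/2) ^ Suc k))" for p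
  have \<phi>: "\<phi> \<in> borel_measurable N"
    unfolding \<phi>_def by measurable
  have \<phi>_id: "\<phi> p = p" if "p \<in> generic" for p
    using sums_unique[OF binary_expansion_fst[OF that]] sums_unique[OF binary_expansion_snd[OF that]]
    unfolding \<phi>_def by (metis prod.collapse)
  fix A assume A: "A \<in> sets square_measure"
  then have "A \<in> sets borel" by (auto simp: sets_restrict_space_iff)
  then have B: "\<phi> -` A \<inter> unit_square \<in> sigma_sets unit_square cylinders"
    using measurable_sets[OF \<phi>] N by simp
  then have [measurable]: "\<phi> -` A \<inter> unit_square \<in> sets square_measure" using sub' by auto
  \<comment> \<open>Points with dyadic coordinates can share all Rademacher values, so
    \<open>A\<close> itself may lie outside the generated sigma-algebra. Its preimage under
    \<open>\<phi>\<close> lies inside and agrees with \<open>A\<close> on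
    \<open>generic\<close>.\<close>
  have "(LINT p:A|square_measure. h p) = (LINT p:\<phi> -` A \<inter> unit_square|square_measure. h p)"
    unfolding set_lebesgue_integral_def
  proof (rule integral_cong_AE)
    show "AE p in square_measure. indicat_real A p *\<^sub>R h p = indicat_real (\<phi> -` A \<inter> unit_square) p *\<^sub>R h p"
      using AE_generic
      by eventually_elim (auto simp: indicator_def \<phi>_id generic_def)
  qed (use A in measurable)
  then show "(LINT p:A|square_measure. h p) = 0" using zero[OF B] by simp
qed

section \<open>Walsh series along orbits\<close>

text \<open>A pointwise substitute for the triangle inequality in the space of square integrable
  functions: the square of the series is bounded by a series of squares, which can be integrated
  term by term. If every \<open>t k\<close> has second moment at most \<open>s\<close>, this yields
  the same constant, the squared total weight times \<open>s\<close>.\<close>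

lemma suminf_weighted_Cauchy_Schwarz:
  fixes a t :: "nat \<Rightarrow> real"
  assumes a: "\<And>k. a k \<ge> 0" "summable a" and t: "\<And>k. \<bar>t k\<bar> \<le> C"
  shows "summable (\<lambda>k. a k * \<bar>t k\<bar>)" "summable (\<lambda>k. a k * (t k)\<^sup>2)"
    "(\<Sum>k. a k * \<bar>t k\<bar>)\<^sup>2 \<le> (\<Sum>k. a k) * (\<Sum>k. a k * (t k)\<^sup>2)"
proof -
  show s1: "summable (\<lambda>k. a k * \<bar>t k\<bar>)"
    using a t by (intro summable_comparison_test'[OF summable_mult2[OF a(2), of C], of 0])
      (auto simp: abs_mult intro!: mult_left_mono)
  have t2: "(t k)\<^sup>2 \<le> C\<^sup>2" for k using power_mono[OF t[of k], of 2] by simp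
  show s2: "summable (\<lambda>k. a k * (t k)\<^sup>2)"
    using a t2 by (intro summable_comparison_test'[OF summable_mult2[OF a(2), of "C\<^sup>2"], of 0])
      (auto simp: abs_mult intro!: mult_left_mono)
  show "(\<Sum>k. a k * \<bar>t k\<bar>)\<^sup>2 \<le> (\<Sum>k. a k) * (\<Sum>k. a k * (t k)\<^sup>2)"
  proof (rule LIMSEQ_le)
    show "(\<lambda>n. (\<Sum>k<n. a k * \<bar>t k\<bar>)\<^sup>2) \<longlonglongrightarrow> (\<Sum>k. a k * \<bar>t k\<bar>)\<^sup>2"
      using s1 by (intro tendsto_power summable_LIMSEQ)
    show "(\<lambda>n. (\<Sum>k<n. a k) * (\<Sum>k<n. a k * (t k)\<^sup>2)) \<longlonglongrightarrow> (\<Sum>k. a k) * (\<Sum>k. a k * (t k)\<^sup>2)"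
      using a s2 by (intro tendsto_mult summable_LIMSEQ)
    have "(\<Sum>k<n. a k * \<bar>t k\<bar>)\<^sup>2 \<le> (\<Sum>k<n. a k) * (\<Sum>k<n. a k * (t k)\<^sup>2)" for n
      using Cauchy_Schwarz_ineq_sum[of "\<lambda>k. sqrt (a k)" "\<lambda>k. sqrt (a k) * \<bar>t k\<bar>" "{..<n}"] a(1)
      by (simp add: power_mult_distrib flip: mult.assoc)
    then show "\<exists>N. \<forall>n\<ge>N. (\<Sum>k<n. a k * \<bar>t k\<bar>)\<^sup>2 \<le> (\<Sum>k<n. a k) * (\<Sum>k<n. a k * (t k)\<^sup>2)" by blast
  qed
qed

lemma summable_walsh_series:
  assumes "summable (\<lambda>k. norm (c k :: complex))"
  shows "summable (\<lambda>k. norm (c k * complex_of_real (walsh2 (e k) p)))"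
    and "summable (\<lambda>k. c k * complex_of_real (walsh2 (e k) p))"
proof -
  show "summable (\<lambda>k. norm (c k * complex_of_real (walsh2 (e k) p)))"
    using assms abs_walsh2_le
    by (intro summable_comparison_test'[OF assms, of 0]) (auto simp: norm_mult mult_left_le)
  then show "summable (\<lambda>k. c k * complex_of_real (walsh2 (e k) p))"
    by (rule summable_norm_cancel)
qed

text \<open>Absolute summability permits termwise integration, and orthonormality leaves only the
  term \<open>m\<close>. Together with \<open>walsh2_complete\<close> this identifies the series
  with the function whose coefficients it carries.\<close>

lemma integral_walsh_series_coeff:
  fixes c :: "nat \<Rightarrow> complex"
  assumes c: "summable (\<lambda>k. norm (c k))" and e: "inj e" "\<And>k. finite (e k)"
  defines "F \<equiv> \<lambda>p. \<Sum>k. c k * complex_of_real (walsh2 (e k) p)"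
  shows "integrable square_measure F"
    and "(\<integral>p. F p * complex_of_real (walsh2 (e m) p) \<partial>square_measure) = c m"
proof -
  interpret finite_measure square_measure by (rule finite_square_measure)
  have int_W: "integrable square_measure (\<lambda>p. complex_of_real (walsh2 K p))" for K
    by (rule integrable_const_bound[of _ 1]) (use abs_walsh2_le in auto)
  have int: "integrable square_measure (\<lambda>p. c k * complex_of_real (walsh2 (e k) p))" for k
    by (intro integrable_mult_right int_W)
  show "integrable square_measure F"
    unfolding F_def
  proof (rule integrable_suminf[OF int])
    show "AE p in square_measure. summable (\<lambda>k. norm (c k * complex_of_real (walsh2 (e k) p)))"
      using summable_walsh_series(1)[OF c] by simp
    show "summable (\<lambda>k. \<integral>p. norm (c k * complex_of_real (walsh2 (e k) p)) \<partial>square_measure)"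
    proof (rule summable_comparison_test'[OF c, of 0])
      fix k
      have "(\<integral>p. norm (c k * complex_of_real (walsh2 (e k) p)) \<partial>square_measure) \<le> (\<integral>p. norm (c k) \<partial>square_measure)"
        using int abs_walsh2_le by (intro integral_mono integrable_norm) (auto simp: norm_mult mult_left_le)
      then show "norm (\<integral>p. norm (c k * complex_of_real (walsh2 (e k) p)) \<partial>square_measure) \<le> norm (c k)"
        by (simp add: measure_def emeasure_square_measure emeasure_unit_square)
    qed
  qed
  define g where "g k p = c k * complex_of_real (walsh2 (e k) p * walsh2 (e m) p)" for k p
  have g_le: "norm (g k p) \<le> norm (c k)" for k p
    using mult_le_one[OF abs_walsh2_le[of "e k" p] _ abs_walsh2_le[of "e m" p]]
    by (simp add: g_def norm_mult mult_left_le abs_mult del: of_real_mult)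
  have g_int: "integrable square_measure (g k)" for k
  proof (rule integrable_const_bound[of _ "norm (c k)"])
    show "g k \<in> borel_measurable square_measure" unfolding g_def by measurable
  qed (use g_le in auto)
  have "(\<integral>p. F p * complex_of_real (walsh2 (e m) p) \<partial>square_measure) = (\<integral>p. (\<Sum>k. g k p) \<partial>square_measure)"
    unfolding F_def g_def
    by (simp add: suminf_mult2[OF summable_walsh_series(2)[OF c]] mult.assoc)
  also have "\<dots> = (\<Sum>k. integral\<^sup>L square_measure (g k))"
  proof (rule integral_suminf[OF g_int])
    show "AE p in square_measure. summable (\<lambda>k. norm (g k p))"
      using g_le by (intro AE_I2 summable_comparison_test'[OF c, of 0]) auto
    show "summable (\<lambda>k. \<integral>p. norm (g k p) \<partial>square_measure)"
    proof (rule summable_comparison_test'[OF c, of 0])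
      fix k
      have "(\<integral>p. norm (g k p) \<partial>square_measure) \<le> (\<integral>p. norm (c k) \<partial>square_measure)"
        using g_int g_le by (intro integral_mono integrable_norm) auto
      then show "norm (\<integral>p. norm (g k p) \<partial>square_measure) \<le> norm (c k)"
        by (simp add: measure_def emeasure_square_measure emeasure_unit_square)
    qed
  qed
  also have "\<dots> = (\<Sum>k. if k = m then c k else 0)"
  proof (rule suminf_cong)
    fix k
    have "integral\<^sup>L square_measure (g k) = c k * complex_of_real (\<integral>p. walsh2 (e k) p * walsh2 (e m) p \<partial>square_measure)"
      unfolding g_def by (simp del: of_real_mult)
    then show "integral\<^sup>L square_measure (g k) = (if k = m then c k else 0)"
      using integral_walsh2_mult[OF e(2) e(2), of k m] injD[OF e(1), of k m] by auto
  qed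
  also have "\<dots> = c m"
    using sums_unique[OF sums_single[of m c]] by simp
  finally show "(\<integral>p. F p * complex_of_real (walsh2 (e m) p) \<partial>square_measure) = c m" .
qed

lemma integral_walsh2_orbit_sum_square:
  assumes "finite K" "K \<noteq> {}"
  shows "(\<integral>\<^sup>+ p. ennreal ((\<Sum>n\<in>{a..<b}. walsh2 ((\<lambda>k. k + int n) ` K) p)\<^sup>2) \<partial>square_measure)
    = ennreal (real (b - a))"
proof -
  interpret finite_measure square_measure by (rule finite_square_measure)
  define w where "w n = walsh2 ((\<lambda>k. k + int n) ` K)" for n
  have [measurable]: "w n \<in> borel_measurable square_measure" for n unfolding w_def by measurable
  \<comment> \<open>The maximum of a finite nonempty set moves with every translation. The empty set
    is fixed by all of them, which is why it is excluded.\<close>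
  have inj: "(\<lambda>k. k + int n) ` K = (\<lambda>k. k + int m) ` K \<longleftrightarrow> n = m" for n m
  proof
    assume eq: "(\<lambda>k. k + int n) ` K = (\<lambda>k. k + int m) ` K"
    have "Max ((\<lambda>k. k + int n) ` K) = Max K + int n" for n
      using assms by (intro mono_Max_commute[symmetric]) (auto simp: mono_def)
    with eq show "n = m" by (metis add_left_cancel of_nat_eq_iff)
  qed simp
  have int: "integrable square_measure (\<lambda>p. w n p * w m p)" for n m
    by (rule integrable_const_bound[of _ 1])
      (use abs_walsh2_le in \<open>auto simp: w_def abs_mult intro!: mult_le_one\<close>)
  have sq: "(\<Sum>n\<in>{a..<b}. w n p)\<^sup>2 = (\<Sum>n\<in>{a..<b}. \<Sum>m\<in>{a..<b}. w n p * w m p)" for p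
    by (simp add: power2_eq_square sum_product)
  have "(\<integral>p. (\<Sum>n\<in>{a..<b}. w n p)\<^sup>2 \<partial>square_measure) = (\<Sum>n\<in>{a..<b}. \<Sum>m\<in>{a..<b}. if n = m then 1 else 0)"
    unfolding sq using int
    by (simp add: integral_sum integrable_sum w_def integral_walsh2_mult assms inj)
  also have "\<dots> = real (b - a)" by simp
  finally have "(\<integral>p. (\<Sum>n\<in>{a..<b}. w n p)\<^sup>2 \<partial>square_measure) = real (b - a)" .
  moreover have "integrable square_measure (\<lambda>p. (\<Sum>n\<in>{a..<b}. w n p)\<^sup>2)"
    unfolding sq using int by simp
  ultimately have "(\<integral>\<^sup>+ p. ennreal ((\<Sum>n\<in>{a..<b}. w n p)\<^sup>2) \<partial>square_measure) = ennreal (real (b - a))"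
    by (subst nn_integral_eq_integral) auto
  then show ?thesis by (simp add: w_def)
qed

text \<open>The orbit sum is moved inside the Walsh series: for fixed nonempty \<open>e k\<close>
  the summands of \<open>S k\<close> are orthonormal, while different \<open>k\<close> are combined
  by the weighted Cauchy--Schwarz inequality. The condition on \<open>e k = {}\<close> expresses
  centring: the constant function would contribute \<open>(b - a) ^ 2\<close> instead of
  \<open>b - a\<close>.\<close>

lemma walsh_series_orbit_L2_bound:
  fixes d :: "nat \<Rightarrow> complex"
  assumes d: "summable (\<lambda>k. norm (d k))" and e: "\<And>k. finite (e k)" "\<And>k. e k = {} \<Longrightarrow> d k = 0"
  defines "F \<equiv> \<lambda>p. \<Sum>k. d k * complex_of_real (walsh2 (e k) p)"
  shows "(\<integral>\<^sup>+ p. ennreal ((norm (\<Sum>n\<in>{a..<b}. F ((baker ^^ n) p)))\<^sup>2) \<partial>square_measure)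
    \<le> ennreal ((\<Sum>k. norm (d k))\<^sup>2 * real (b - a))"
proof -
  define A where "A = (\<Sum>k. norm (d k))"
  have A: "A \<ge> 0" unfolding A_def by (intro suminf_nonneg d) auto
  define S where "S k p = (\<Sum>n\<in>{a..<b}. walsh2 ((\<lambda>i. i + int n) ` e k) p)" for k p
  have [measurable]: "S k \<in> borel_measurable square_measure" for k unfolding S_def by measurable
  have S: "\<bar>S k p\<bar> \<le> real (b - a)" for k p
  proof -
    have "\<bar>S k p\<bar> \<le> (\<Sum>n\<in>{a..<b}. \<bar>walsh2 ((\<lambda>i. i + int n) ` e k) p\<bar>)"
      unfolding S_def by (rule sum_abs)
    also have "\<dots> \<le> (\<Sum>n\<in>{a..<b}. 1)" by (intro sum_mono abs_walsh2_le)
    finally show ?thesis by simp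
  qed
  note CS = suminf_weighted_Cauchy_Schwarz[of "\<lambda>k. norm (d k)", OF _ d S]
  have bound: "(norm (\<Sum>n\<in>{a..<b}. F ((baker ^^ n) p)))\<^sup>2 \<le> A * (\<Sum>k. norm (d k) * (S k p)\<^sup>2)"
    if p: "p \<in> generic" for p
  proof -
    have "(\<Sum>n\<in>{a..<b}. F ((baker ^^ n) p))
        = (\<Sum>n\<in>{a..<b}. \<Sum>k. d k * complex_of_real (walsh2 ((\<lambda>i. i + int n) ` e k) p))"
      unfolding F_def by (simp add: walsh2_baker_funpow[OF p])
    also have "\<dots> = (\<Sum>k. \<Sum>n\<in>{a..<b}. d k * complex_of_real (walsh2 ((\<lambda>i. i + int n) ` e k) p))"
      by (intro suminf_sum[symmetric] summable_walsh_series(2)[OF d])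
    also have "\<dots> = (\<Sum>k. d k * complex_of_real (S k p))"
      by (simp add: S_def sum_distrib_left)
    finally have eq: "(\<Sum>n\<in>{a..<b}. F ((baker ^^ n) p)) = (\<Sum>k. d k * complex_of_real (S k p))" .
    have "norm (\<Sum>k. d k * complex_of_real (S k p)) \<le> (\<Sum>k. norm (d k * complex_of_real (S k p)))"
      using CS(1) by (intro summable_norm) (simp add: norm_mult)
    also have "\<dots> = (\<Sum>k. norm (d k) * \<bar>S k p\<bar>)" by (simp add: norm_mult)
    finally have "(norm (\<Sum>k. d k * complex_of_real (S k p)))\<^sup>2 \<le> (\<Sum>k. norm (d k) * \<bar>S k p\<bar>)\<^sup>2"
      by (intro power_mono) auto
    also have "\<dots> \<le> A * (\<Sum>k. norm (d k) * (S k p)\<^sup>2)"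
      unfolding A_def by (rule CS(3)) simp
    finally show ?thesis unfolding eq .
  qed
  have "(\<integral>\<^sup>+ p. ennreal ((norm (\<Sum>n\<in>{a..<b}. F ((baker ^^ n) p)))\<^sup>2) \<partial>square_measure)
      \<le> (\<integral>\<^sup>+ p. ennreal A * (\<Sum>k. ennreal (norm (d k)) * ennreal ((S k p)\<^sup>2)) \<partial>square_measure)"
  proof (rule nn_integral_mono_AE)
    show "AE p in square_measure. ennreal ((norm (\<Sum>n\<in>{a..<b}. F ((baker ^^ n) p)))\<^sup>2)
        \<le> ennreal A * (\<Sum>k. ennreal (norm (d k)) * ennreal ((S k p)\<^sup>2))"
      using AE_generic
    proof eventually_elim
      case (elim p)
      have "ennreal A * (\<Sum>k. ennreal (norm (d k)) * ennreal ((S k p)\<^sup>2))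
          = ennreal A * ennreal (\<Sum>k. norm (d k) * (S k p)\<^sup>2)"
        using CS(2) by (subst suminf_ennreal2[symmetric]) (auto simp: ennreal_mult)
      also have "\<dots> = ennreal (A * (\<Sum>k. norm (d k) * (S k p)\<^sup>2))"
        using A CS(2) by (intro ennreal_mult[symmetric] suminf_nonneg) auto
      finally show ?case using bound[OF elim] by (simp add: ennreal_leI)
    qed
  qed
  also have "\<dots> = ennreal A * (\<Sum>k. ennreal (norm (d k)) * (\<integral>\<^sup>+ p. ennreal ((S k p)\<^sup>2) \<partial>square_measure))"
    by (simp add: nn_integral_cmult nn_integral_suminf)
  also have "\<dots> = ennreal A * (\<Sum>k. ennreal (norm (d k) * real (b - a)))"
  proof (intro arg_cong2[where f = "(*)"] refl suminf_cong)
    fix k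
    show "ennreal (norm (d k)) * (\<integral>\<^sup>+ p. ennreal ((S k p)\<^sup>2) \<partial>square_measure) = ennreal (norm (d k) * real (b - a))"
    proof (cases "e k = {}")
      case False
      then show ?thesis
        using integral_walsh2_orbit_sum_square[OF e(1), of k a b] by (simp add: S_def ennreal_mult)
    qed (simp add: e(2))
  qed
  also have "(\<Sum>k. ennreal (norm (d k) * real (b - a))) = ennreal (A * real (b - a))"
    unfolding A_def using d by (subst suminf_ennreal2) (auto simp: suminf_mult2 intro: summable_mult2)
  also have "ennreal A * ennreal (A * real (b - a)) = ennreal (A\<^sup>2 * real (b - a))"
    using A by (simp add: power2_eq_square mult.assoc flip: ennreal_mult)
  finally show ?thesis unfolding A_def .
qed

text \<open>By invariance each iterate pulls the exceptional null set back to a null set, and there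
  are countably many iterates.\<close>

lemma AE_baker_orbit:
  assumes "AE p in square_measure. P p"
  shows "AE p in square_measure. \<forall>n. P ((baker ^^ n) p)"
proof -
  have "AE p in square_measure. P ((baker ^^ n) p)" for n
  proof (induction n)
    case (Suc n)
    then have "AE p in distr square_measure square_measure baker. P ((baker ^^ n) p)"
      by (simp only: distr_baker)
    from AE_distrD[OF baker_measurable_square this] show ?case
      by (simp add: funpow_Suc_right del: funpow.simps)
  qed (use assms in simp)
  then show ?thesis by (simp add: AE_all_countable)
qed

section \<open>From Borel to Lebesgue measurability\<close>

lemma AE_lebesgue_on_unit_square:
  "(AE p in lebesgue_on unit_square. P p) \<longleftrightarrow> (AE p in square_measure. P p)"
  by (simp add: AE_restrict_space_iff AE_completion_iff)

lemma integral_lebesgue_on_unit_square: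
  fixes u :: "real \<times> real \<Rightarrow> 'b::{banach, second_countable_topology}"
  assumes "u \<in> borel_measurable square_measure"
  shows "integral\<^sup>L (lebesgue_on unit_square) u = integral\<^sup>L square_measure u"
    and "integrable (lebesgue_on unit_square) u \<longleftrightarrow> integrable square_measure u"
proof -
  have "(\<lambda>p. indicator unit_square p *\<^sub>R u p) \<in> borel_measurable lborel"
    using assms by (subst (asm) borel_measurable_restrict_space_iff) auto
  then show "integral\<^sup>L (lebesgue_on unit_square) u = integral\<^sup>L square_measure u"
    and "integrable (lebesgue_on unit_square) u \<longleftrightarrow> integrable square_measure u"
    by (simp_all add: integral_restrict_space integrable_restrict_space integral_completion integrable_completion)
qed

text \<open>\<open>lebesgue\<close> completes \<open>lborel\<close>, so measurable functions differ
  from Borel ones only on null sets. Extending \<open>f\<close> by 0 moves the question to the whole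
  plane, where real and imaginary parts are treated separately.\<close>

lemma lebesgue_on_unit_square_borel_version:
  fixes f :: "real \<times> real \<Rightarrow> complex"
  assumes "f \<in> borel_measurable (lebesgue_on unit_square)"
  obtains g where "g \<in> borel_measurable square_measure" "AE p in lebesgue_on unit_square. f p = g p"
proof -
  define h where "h p = indicator unit_square p *\<^sub>R f p" for p
  have h: "h \<in> borel_measurable lebesgue"
    using assms unfolding h_def by (subst (asm) borel_measurable_restrict_space_iff) auto
  have "(\<lambda>p. Re (h p)) \<in> borel_measurable lebesgue" "(\<lambda>p. Im (h p)) \<in> borel_measurable lebesgue"
    using h by auto
  then obtain r i where ri: "r \<in> borel_measurable lborel" "AE p in lborel. Re (h p) = r p"
    "i \<in> borel_measurable lborel" "AE p in lborel. Im (h p) = i p"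
    by (auto dest!: completion_ex_borel_measurable_real)
  show thesis
  proof
    show "(\<lambda>p. Complex (r p) (i p)) \<in> borel_measurable square_measure"
      using ri by (intro measurable_restrict_space1) (simp add: borel_measurable_complex_iff)
    have "AE p in lborel. h p = Complex (r p) (i p)"
      using ri(2,4) by eventually_elim (simp add: complex_eq_iff)
    then have "AE p in lborel. p \<in> unit_square \<longrightarrow> f p = Complex (r p) (i p)"
      by eventually_elim (auto simp: h_def)
    then show "AE p in lebesgue_on unit_square. f p = Complex (r p) (i p)"
      unfolding AE_lebesgue_on_unit_square by (simp add: AE_restrict_space_iff)
  qed
qed

text \<open>An enumeration turns unordered summability over index sets into ordinary series; the
  singletons show that there are infinitely many of them.\<close>

lemma enumerate_finite_int_sets:
  obtains e :: "nat \<Rightarrow> int set" where "bij_betw e UNIV {K. finite K}"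
proof -
  have "infinite ((\<lambda>k::int. {k}) ` UNIV)"
    by (subst finite_image_iff) (auto simp: inj_on_def infinite_UNIV_int)
  then have "infinite {K :: int set. finite K}"
    by (rule contrapos_nn) (auto elim: finite_subset[rotated])
  then show thesis
    using that bij_betw_from_nat_into[OF countable_Collect_finite] by blast
qed

theorem corollary1p4:
  fixes f :: "real \<times> real \<Rightarrow> complex" and \<eta> :: real
  assumes "L2_fun (lebesgue_on unit_square) f"
    and "abs_convergent_walsh2 f"
    and "\<eta> > 0"
  shows "AE p in lebesgue_on unit_square.
    (\<lambda>N::nat. sqrt (real N) / ln (1 + real N) powr (3/2 + \<eta>) *
       norm ((1 / of_nat N) * (\<Sum>n<N. f ((baker ^^ n) p))
             - integral\<^sup>L (lebesgue_on unit_square) f))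
    \<longlonglongrightarrow> 0"
proof -
  have f: "f \<in> borel_measurable (lebesgue_on unit_square)"
    "integrable (lebesgue_on unit_square) (\<lambda>p. (norm (f p))\<^sup>2)"
    using assms(1) by (auto simp: L2_fun_def)
  note [measurable] = f(1)
  obtain g where g [measurable]: "g \<in> borel_measurable square_measure"
    and fg: "AE p in lebesgue_on unit_square. f p = g p"
    using lebesgue_on_unit_square_borel_version[OF f(1)] .
  have g' [measurable]: "g \<in> borel_measurable (lebesgue_on unit_square)"
  proof -
    have "(\<lambda>p. indicator unit_square p *\<^sub>R g p) \<in> borel_measurable lborel"
      using g by (subst (asm) borel_measurable_restrict_space_iff) auto
    then show ?thesis
      by (subst borel_measurable_restrict_space_iff) (auto intro: measurable_completion)
  qed
  have W' [measurable]: "walsh2 K \<in> borel_measurable (lebesgue_on unit_square)" for K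
    by (intro measurable_restrict_space1 measurable_completion) simp
  \<comment> \<open>On a finite measure space square integrability gives integrability through
    \<open>t \<le> 1 + t ^ 2\<close>; completeness is stated for integrable functions.\<close>
  have "integrable (lebesgue_on unit_square) f"
  proof (rule Bochner_Integration.integrable_bound)
    interpret finite_measure "lebesgue_on unit_square"
      by (rule finite_measureI) (simp add: space_restrict_space emeasure_restrict_space emeasure_unit_square)
    show "integrable (lebesgue_on unit_square) (\<lambda>p. 1 + (norm (f p))\<^sup>2)"
      using f(2) by simp
    have "norm z \<le> 1 + (norm z)\<^sup>2" for z :: complex
      using self_le_power[of "norm z" 2] by (cases "norm z \<ge> 1") (auto intro: add_increasing2)
    then show "AE p in lebesgue_on unit_square. norm (f p) \<le> norm (1 + (norm (f p))\<^sup>2)"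
      by (auto simp: abs_of_nonneg)
  qed (rule f(1))
  then have "integrable (lebesgue_on unit_square) g"
    using fg by (subst (asm) integrable_cong_AE) auto
  then have int_g: "integrable square_measure g"
    by (simp add: integral_lebesgue_on_unit_square)
  have coeff: "walsh2_coeff f K = (\<integral>p. g p * complex_of_real (walsh2 K p) \<partial>square_measure)" for K
  proof -
    have "walsh2_coeff f K = (\<integral>p. g p * complex_of_real (walsh2 K p) \<partial>lebesgue_on unit_square)"
      unfolding walsh2_coeff_def by (rule integral_cong_AE, measurable) (use fg in auto)
    also have "\<dots> = (\<integral>p. g p * complex_of_real (walsh2 K p) \<partial>square_measure)"
      by (rule integral_lebesgue_on_unit_square) measurable
    finally show ?thesis .
  qed
  obtain e :: "nat \<Rightarrow> int set" where e: "bij_betw e UNIV {K. finite K}"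
    using enumerate_finite_int_sets .
  then have e_inj: "inj e" and e_fin: "\<And>k. finite (e k)"
    and e_surj: "\<And>K. finite K \<Longrightarrow> \<exists>k. K = e k"
    by (auto simp: bij_betw_def)
  define c where "c k = walsh2_coeff f (e k)" for k
  have c: "summable (\<lambda>k. norm (c k))"
    using assms(2) unfolding abs_convergent_walsh2_def c_def
    by (subst (asm) summable_on_reindex_bij_betw[OF e, symmetric])
      (simp add: summable_on_UNIV_nonneg_real_iff)
  define F where "F p = (\<Sum>k. c k * complex_of_real (walsh2 (e k) p))" for p
  have F: "integrable square_measure F"
    and F_coeff: "\<And>m. (\<integral>p. F p * complex_of_real (walsh2 (e m) p) \<partial>square_measure) = c m"
    unfolding F_def using integral_walsh_series_coeff[OF c e_inj e_fin] by auto
  have "AE p in square_measure. g p - F p = 0"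
  proof (rule walsh2_complete)
    fix K :: "int set" assume "finite K"
    then obtain m where "K = e m" using e_surj by blast
    then show "(\<integral>p. (g p - F p) * complex_of_real (walsh2 K p) \<partial>square_measure) = 0"
      using F_coeff[of m] coeff[of K]
      by (simp add: left_diff_distrib integrable_mult_walsh2 int_g F c_def)
  qed (use int_g F in auto)
  then have "AE p in square_measure. f p = F p"
    using fg unfolding AE_lebesgue_on_unit_square by eventually_elim simp
  then have f_orbit: "AE p in square_measure. \<forall>n. f ((baker ^^ n) p) = F ((baker ^^ n) p)"
    by (rule AE_baker_orbit)
  \<comment> \<open>The index of the constant function carries the mean of \<open>f\<close>.
    Deleting its coefficient centres the series, so that \<open>walsh_series_orbit_L2_bound\<close>
    applies to \<open>D\<close>.\<close>
  obtain z where z: "{} = e z" using e_surj[of "{}"] by auto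
  have c_z: "c z = integral\<^sup>L (lebesgue_on unit_square) f"
    unfolding c_def walsh2_coeff_def z[symmetric] by (simp add: walsh2_def)
  define d where "d k = (if k = z then 0 else c k)" for k
  have d: "summable (\<lambda>k. norm (d k))"
    by (rule summable_comparison_test'[OF c, of 0]) (auto simp: d_def)
  have d_z: "d k = 0" if "e k = {}" for k
    using that z e_inj by (auto simp: d_def dest: injD)
  define D where "D p = (\<Sum>k. d k * complex_of_real (walsh2 (e k) p))" for p
  have [measurable]: "D \<in> borel_measurable square_measure"
    unfolding D_def by measurable
  have FD: "F p = D p + c z" for p
  proof -
    have "(\<lambda>k. if k = z then c k else 0) sums c z" by (rule sums_single)
    moreover have "(\<lambda>k. d k * complex_of_real (walsh2 (e k) p)) sums D p"
      unfolding D_def by (intro summable_sums summable_walsh_series(2) d)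
    ultimately have "(\<lambda>k. d k * complex_of_real (walsh2 (e k) p) + (if k = z then c k else 0)) sums (D p + c z)"
      by (intro sums_add)
    also have "(\<lambda>k. d k * complex_of_real (walsh2 (e k) p) + (if k = z then c k else 0))
        = (\<lambda>k. c k * complex_of_real (walsh2 (e k) p))"
      by (auto simp: fun_eq_iff d_def walsh2_def z[symmetric])
    finally show ?thesis unfolding F_def by (simp add: sums_iff)
  qed
  have funpow_meas: "baker ^^ n \<in> measurable square_measure square_measure" for n
    by (induction n)
      (auto simp del: o_apply intro: measurable_comp[OF _ baker_measurable_square] simp: id_def)
  have "AE p in square_measure. (\<lambda>N. norm (\<Sum>n<N. D ((baker ^^ n) p)) /
      (sqrt (real N) * ln (1 + real N) powr (3/2 + \<eta>))) \<longlonglongrightarrow> 0"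
  proof (rule rademacher_menshov_rate[where X = "\<lambda>n p. D ((baker ^^ n) p)"])
    show "(\<lambda>p. D ((baker ^^ n) p)) \<in> borel_measurable square_measure" for n
      by (rule measurable_compose[OF funpow_meas]) measurable
    show "(\<integral>\<^sup>+ p. ennreal ((norm (\<Sum>n\<in>{a..<b}. D ((baker ^^ n) p)))\<^sup>2) \<partial>square_measure)
        \<le> ennreal ((\<Sum>k. norm (d k))\<^sup>2 * real (b - a))" for a b
      unfolding D_def by (rule walsh_series_orbit_L2_bound[OF d e_fin d_z])
  qed (use assms(3) in auto)
  then show ?thesis
    unfolding AE_lebesgue_on_unit_square using f_orbit
  proof eventually_elim
    case (elim p)
    have "sqrt (real N) / ln (1 + real N) powr (3/2 + \<eta>) *
        norm ((1 / of_nat N) * (\<Sum>n<N. f ((baker ^^ n) p)) - integral\<^sup>L (lebesgue_on unit_square) f)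
      = norm (\<Sum>n<N. D ((baker ^^ n) p)) / (sqrt (real N) * ln (1 + real N) powr (3/2 + \<eta>))" for N
    \<comment> \<open>At \<open>N = 0\<close> both sides vanish because \<open>sqrt 0 = 0\<close>
      and division by 0 gives 0.\<close>
    proof (cases "N = 0")
      case False
      have "(1 / of_nat N) * (\<Sum>n<N. f ((baker ^^ n) p)) - integral\<^sup>L (lebesgue_on unit_square) f
          = (\<Sum>n<N. D ((baker ^^ n) p)) / of_nat N"
        using False elim(2) by (simp add: FD sum.distrib c_z[symmetric] field_simps)
      then have "norm ((1 / of_nat N) * (\<Sum>n<N. f ((baker ^^ n) p)) - integral\<^sup>L (lebesgue_on unit_square) f)
          = norm (\<Sum>n<N. D ((baker ^^ n) p)) / (sqrt (real N) * sqrt (real N))"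
        by (simp add: norm_divide)
      moreover have "r / L * (x / (r * r)) = x / (r * L)" if "r \<noteq> 0" for r L x :: real
        using that by simp
      ultimately show ?thesis using False by (simp only: of_nat_eq_0_iff real_sqrt_eq_zero_cancel_iff not_False_eq_True)
    qed simp
    then show ?case using elim(1) by simp
  qed
qed

end
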